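(* Let $E$ be an infinite-dimensional Banach space with an unconditional basis and with an equivalent norm that is $C^1$ (away from the origin) and locally depends on finitely many coordinates. Let $U$ be an open subset of $E$, $f:U\to\mathbb{R}^d$ a $C^1$ function and $\varepsilon:U\to(0,\infty)$ a continuous function. Then there exists a $C^1$ function $g:U\to\mathbb{R}^d$ such that: (1) $\|f(x)-g(x)\|\leq\varepsilon(x)$ for every $x\in U$; (2) $\|Df(x)-Dg(x)\|\leq\varepsilon(x)$ for every $x\in U$; (3) $Dg(x)$ is surjective for every $x\in U$, i.e. $g$ has no critical points.
   Context: A norm $\|\cdot\|$ on $E$ locally depends on finitely many coordinates if for every $x\in E$ there exist a natural number $l_x$, an open neighbourhood $U_x$ of $x$, functionals $L_1,\dots,L_{l_x}\in E^*$ and a function $\gamma:\mathbb{R}^{l_x}\to\mathbb{R}$ such that $\|y\|=\gamma(L_1(y),\dots,L_{l_x}(y))$ for every $y\in U_x$. The norm on $\mathbb{R}^d$ is Euclidean; norms of linear maps are operator norms. *)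

theory Defs
  imports "HOL-Analysis.Analysis"
begin

definition infinite_dimensional :: "'a::real_vector itself \<Rightarrow> bool" where
  "infinite_dimensional _ \<longleftrightarrow> (\<forall>B::'a set. finite B \<longrightarrow> span B \<noteq> UNIV)"

definition schauder_basis :: "(nat \<Rightarrow> 'a::real_normed_vector) \<Rightarrow> bool" where
  "schauder_basis e \<longleftrightarrow> (\<forall>x. \<exists>!a::nat \<Rightarrow> real. (\<lambda>n. a n *\<^sub>R e n) sums x)"

definition unconditional_basis :: "(nat \<Rightarrow> 'a::real_normed_vector) \<Rightarrow> bool" where
  "unconditional_basis e \<longleftrightarrow> schauder_basis e \<and>
     (\<forall>a x. (\<lambda>n. a n *\<^sub>R e n) sums x \<longrightarrow> ((\<lambda>n. a n *\<^sub>R e n) has_sum x) UNIV)"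

definition is_norm_fun :: "('a::real_vector \<Rightarrow> real) \<Rightarrow> bool" where
  "is_norm_fun N \<longleftrightarrow> (\<forall>x. 0 \<le> N x) \<and> (\<forall>x. N x = 0 \<longleftrightarrow> x = 0) \<and>
     (\<forall>c x. N (c *\<^sub>R x) = \<bar>c\<bar> * N x) \<and> (\<forall>x y. N (x + y) \<le> N x + N y)"

definition equivalent_norm :: "('a::real_normed_vector \<Rightarrow> real) \<Rightarrow> bool" where
  "equivalent_norm N \<longleftrightarrow> is_norm_fun N \<and>
     (\<exists>c C. 0 < c \<and> 0 < C \<and> (\<forall>x. c * norm x \<le> N x \<and> N x \<le> C * norm x))"

definition C1_away_from_origin :: "('a::real_normed_vector \<Rightarrow> real) \<Rightarrow> bool" where
  "C1_away_from_origin N \<longleftrightarrow> (\<exists>N' :: 'a \<Rightarrow> ('a \<Rightarrow>\<^sub>L real).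
     (\<forall>x. x \<noteq> 0 \<longrightarrow> (N has_derivative blinfun_apply (N' x)) (at x)) \<and>
     continuous_on (- {0}) N')"

definition locally_depends_on_finitely_many_coords :: "('a::real_normed_vector \<Rightarrow> real) \<Rightarrow> bool" where
  "locally_depends_on_finitely_many_coords N \<longleftrightarrow>
     (\<forall>x. x \<noteq> 0 \<longrightarrow> (\<exists>(V::'a set) (Ls :: ('a \<Rightarrow>\<^sub>L real) list) (\<gamma> :: real list \<Rightarrow> real).
        open V \<and> x \<in> V \<and> (\<forall>y\<in>V. N y = \<gamma> (map (\<lambda>L. blinfun_apply L y) Ls))))"

end

theory Submission
  imports Defs
begin

text \<open>Fix a countable set \<open>Z\<close> of functionals. If every derivative \<open>Dh x\<close> vanishes on the common kernel of
  finitely many members of \<open>Z\<close>, then \<open>h\<close> loses all its critical points after adding a small multiple of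
  a linear map \<open>T\<close> that is onto on every such kernel. As \<open>Z\<close> is countable and \<open>E\<close> is
  infinite-dimensional, the Baire category theorem in the dual space provides \<open>T\<close>.

  To approximate \<open>f\<close> by such an \<open>h\<close>, use the smooth norm and the basis to build a \<open>C\<^sup>1\<close> map \<open>\<Psi>\<close> that is
  uniformly close to the identity, locally takes values in the span of finitely many basis vectors,
  and whose derivative is bounded by a constant independent of the closeness. Near a point \<open>a\<close> at which
  \<open>f - Df a\<close> has a small Lipschitz constant, \<open>(f - Df a) \<circ> \<Psi> + Df a\<close> is \<open>C\<^sup>1\<close>-close to \<open>f\<close>. These local
  approximations, already perturbed by multiples of \<open>T\<close>, are glued by a partition of unity made from
  the norm; separability keeps all functionals involved in a countable set.\<close>

section \<open>Unconditional bases\<close>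

text \<open>Every \<open>D\<Psi> x\<close> has finite rank, so in an infinite-dimensional space it
  is never close to the identity, and composing \<open>f\<close> itself with \<open>\<Psi>\<close>
  would not approximate \<open>Df\<close>. This is why \<open>Df a\<close> is split off: only the
  remainder, whose derivative is small near \<open>a\<close>, is composed with
  \<open>\<Psi>\<close>, and then a mere bound for \<open>D\<Psi>\<close> suffices. The price is
  that the operators \<open>Df a\<close> must be absorbed into \<open>Z\<close>, which works because
  their target is finite-dimensional and countably many \<open>a\<close> are enough.

  The order of choices is delicate, as \<open>T\<close> depends on \<open>Z\<close> while the glued
  functions contain \<open>T\<close>. By the product rule a glued derivative consists of vectors
  multiplied by some \<open>D\<phi> n\<close> and of weighted derivatives of local pieces. The
  former vanish on the kernel of \<open>D\<phi> n\<close> whatever the vector is, so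
  \<open>Z\<close> can be fixed before \<open>T\<close>. In the latter \<open>T\<close> has
  nonnegative weights, at least one of them positive, so its multiples cannot cancel.

  Unconditionality is needed because the coefficients in \<open>\<Psi>\<close> change with the index
  and with the point: such sums are controlled by uniform bounds for bounded multipliers.\<close>

lemma Baire_union_interior:
  fixes F :: "nat \<Rightarrow> 'a::{metric_space, complete_space} set"
  assumes "\<And>n. closed (F n)" and "(\<Union>n. F n) = UNIV"
  shows "\<exists>n. interior (F n) \<noteq> {}"
proof (rule ccontr)
  assume "\<nexists>n. interior (F n) \<noteq> {}"
  then have "euclidean interior_of \<Union>(range F) = {}"
    by (intro Baire_category_alt)
       (auto simp: assms completely_metrizable_space_euclidean)
  then show False
    using assms(2) by simp
qed

lemma Baire_inter_nonempty:
  fixes G :: "nat \<Rightarrow> 'a::{metric_space, complete_space} set"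
  assumes "\<And>n. open (G n)" and "\<And>n. closure (G n) = UNIV"
  shows "\<exists>x. \<forall>n. x \<in> G n"
proof (rule ccontr)
  assume "\<not> ?thesis"
  then have "(\<Union>n. - G n) = UNIV"
    by auto
  from Baire_union_interior[OF _ this] assms obtain n where "interior (- G n) \<noteq> {}"
    by (auto simp: closed_Compl)
  then show False
    using assms(2)[of n] by (simp add: interior_complement)
qed

text \<open>A sum with coefficients in [0,1] is a convex combination of the subset sums, and the
  norm is convex. The induction removes one index at a time; the offset \<open>w\<close> carries the
  terms already decided upon.\<close>

lemma norm_sum_scaleR_le_of_subsets:
  fixes z :: "'i \<Rightarrow> 'a::real_normed_vector"
  assumes "finite A" and "\<And>i. i \<in> A \<Longrightarrow> 0 \<le> \<theta> i \<and> \<theta> i \<le> 1"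
    and "\<And>B. B \<subseteq> A \<Longrightarrow> norm (w + sum z B) \<le> M"
  shows "norm (w + (\<Sum>i\<in>A. \<theta> i *\<^sub>R z i)) \<le> M"
  using assms
proof (induction A arbitrary: w rule: finite_induct)
  case empty
  from empty(2)[of "{}"] show ?case by simp
next
  case (insert j A)
  let ?S = "\<Sum>i\<in>A. \<theta> i *\<^sub>R z i"
  have 1: "norm (w + ?S) \<le> M"
    using insert.prems by (intro insert.IH) auto
  have 2: "norm ((w + z j) + ?S) \<le> M"
  proof (rule insert.IH)
    fix B assume "B \<subseteq> A"
    then have "norm (w + sum z (insert j B)) \<le> M"
      by (intro insert.prems) auto
    moreover have "sum z (insert j B) = z j + sum z B"
      using \<open>B \<subseteq> A\<close> insert.hyps by (subst sum.insert) (auto intro: finite_subset)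
    ultimately show "norm (w + z j + sum z B) \<le> M"
      by (simp add: add.assoc)
  qed (use insert.prems in auto)
  have t: "0 \<le> \<theta> j" "\<theta> j \<le> 1"
    using insert.prems by auto
  have "w + (\<Sum>i\<in>insert j A. \<theta> i *\<^sub>R z i) = (1 - \<theta> j) *\<^sub>R (w + ?S) + \<theta> j *\<^sub>R ((w + z j) + ?S)"
    using insert.hyps by (simp add: algebra_simps)
  also have "norm \<dots> \<le> (1 - \<theta> j) * norm (w + ?S) + \<theta> j * norm ((w + z j) + ?S)"
    using t by (intro norm_triangle_le) simp
  also have "\<dots> \<le> (1 - \<theta> j) * M + \<theta> j * M"
    using 1 2 t by (intro add_mono mult_left_mono) auto
  finally show ?case
    by (simp add: algebra_simps)
qed

locale unconditional_schauder_basis =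
  fixes e :: "nat \<Rightarrow> 'a::banach"
  assumes unconditional: "unconditional_basis e"
begin

definition coord :: "'a \<Rightarrow> nat \<Rightarrow> real" where
  "coord x = (THE a. (\<lambda>n. a n *\<^sub>R e n) sums x)"

lemma ex1_expansion: "\<exists>!a. (\<lambda>n. a n *\<^sub>R e n) sums x"
  using unconditional unfolding unconditional_basis_def schauder_basis_def by blast

lemma sums_coord: "(\<lambda>n. coord x n *\<^sub>R e n) sums x"
  unfolding coord_def by (rule theI'[OF ex1_expansion])

lemma coord_eqI: "(\<lambda>n. a n *\<^sub>R e n) sums x \<Longrightarrow> coord x = a"
  using ex1_expansion sums_coord by blast

lemma coord_add: "coord (x + y) n = coord x n + coord y n"
proof -
  have "coord (x + y) = (\<lambda>n. coord x n + coord y n)"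
    by (rule coord_eqI) (simp add: scaleR_add_left sums_add sums_coord)
  then show ?thesis by simp
qed

lemma coord_scaleR: "coord (c *\<^sub>R x) n = c * coord x n"
proof -
  have "coord (c *\<^sub>R x) = (\<lambda>n. c * coord x n)"
    using sums_scaleR_right[OF sums_coord, of c x] by (intro coord_eqI) simp
  then show ?thesis by simp
qed

lemma linear_coord: "linear (\<lambda>x. coord x n)"
  by (rule linearI) (auto simp: coord_add coord_scaleR)

lemma coord_sum: "coord (sum f A) n = (\<Sum>i\<in>A. coord (f i) n)"
  using linear_sum[OF linear_coord] by simp

lemma basis_nonzero: "e n \<noteq> 0"
proof
  assume "e n = 0"
  have "coord 0 = (\<lambda>_. 0)"
    by (rule coord_eqI) simp
  moreover have "coord 0 = (\<lambda>k. if k = n then 1 else 0)"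
    by (rule coord_eqI) (use \<open>e n = 0\<close> in \<open>simp add: if_distrib[of "\<lambda>c. c *\<^sub>R _"] cong: if_cong\<close>)
  ultimately show False
    by (metis zero_neq_one)
qed

lemma coord_nonzero:
  assumes "x \<noteq> 0"
  shows "\<exists>n. coord x n \<noteq> 0"
proof (rule ccontr)
  assume "\<not> ?thesis"
  then have "(\<lambda>n. 0) sums x"
    using sums_coord[of x] by simp
  then show False
    using assms sums_unique2[OF sums_zero] by blast
qed

text \<open>Convergence along finite sets controls every set that contains \<open>A0\<close>. An
  arbitrary \<open>A\<close> is compared with \<open>A \<union> A0\<close>, and the difference is a
  subsum over the fixed finite set \<open>A0\<close>. The bound still depends on
  \<open>x\<close>.\<close>

lemma partial_sums_bounded:
  "\<exists>M. \<forall>A. finite A \<longrightarrow> norm (\<Sum>n\<in>A. coord x n *\<^sub>R e n) \<le> M"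
proof -
  let ?z = "\<lambda>n. coord x n *\<^sub>R e n"
  have "(?z has_sum x) UNIV"
    using unconditional sums_coord unfolding unconditional_basis_def by blast
  then have "\<forall>\<^sub>F A in finite_subsets_at_top UNIV. dist (sum ?z A) x < 1"
    unfolding has_sum_def by (rule tendstoD) simp
  then obtain A0 where A0: "finite A0" and
    far: "\<And>A. finite A \<Longrightarrow> A0 \<subseteq> A \<Longrightarrow> dist (sum ?z A) x < 1"
    unfolding eventually_finite_subsets_at_top by auto
  have "norm (sum ?z A) \<le> norm x + 1 + (\<Sum>n\<in>A0. norm (?z n))" if "finite A" for A
  proof -
    have "sum ?z (A \<union> A0) = sum ?z A + sum ?z (A0 - A)"
      by (metis A0 Un_Diff_cancel finite_Diff that sum.union_disjoint Diff_disjoint)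
    then have "norm (sum ?z A) \<le> norm (sum ?z (A \<union> A0)) + norm (sum ?z (A0 - A))"
      by (metis add_diff_cancel_right' norm_triangle_ineq4)
    also have "norm (sum ?z (A \<union> A0)) \<le> norm x + 1"
      using far[of "A \<union> A0"] A0 that norm_triangle_sub[of "sum ?z (A \<union> A0)" x]
      by (simp add: dist_norm)
    also have "norm (sum ?z (A0 - A)) \<le> (\<Sum>n\<in>A0. norm (?z n))"
      using A0 by (intro sum_norm_le[THEN order_trans, OF _ sum_mono2]) auto
    finally show ?thesis by simp
  qed
  then show ?thesis by blast
qed

section \<open>The unconditional constant, by an open mapping argument\<close>

definition uball :: "real \<Rightarrow> 'a set" where
  "uball M = {x. \<forall>A. finite A \<longrightarrow> norm (\<Sum>n\<in>A. coord x n *\<^sub>R e n) \<le> M}"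

lemma uballI: "(\<And>A. finite A \<Longrightarrow> norm (\<Sum>n\<in>A. coord x n *\<^sub>R e n) \<le> M) \<Longrightarrow> x \<in> uball M"
  by (simp add: uball_def)

lemma uballD: "x \<in> uball M \<Longrightarrow> finite A \<Longrightarrow> norm (\<Sum>n\<in>A. coord x n *\<^sub>R e n) \<le> M"
  by (simp add: uball_def)

lemma scaleR_uball:
  assumes "x \<in> uball M"
  shows "c *\<^sub>R x \<in> uball (\<bar>c\<bar> * M)"
proof (rule uballI)
  fix A :: "nat set" assume "finite A"
  have "norm (\<Sum>n\<in>A. coord (c *\<^sub>R x) n *\<^sub>R e n) = norm (c *\<^sub>R (\<Sum>n\<in>A. coord x n *\<^sub>R e n))"
    by (simp add: coord_scaleR scaleR_sum_right)
  also have "\<dots> \<le> \<bar>c\<bar> * M"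
    using uballD[OF assms \<open>finite A\<close>] by (simp add: mult_left_mono)
  finally show "norm (\<Sum>n\<in>A. coord (c *\<^sub>R x) n *\<^sub>R e n) \<le> \<bar>c\<bar> * M" .
qed

lemma add_uball:
  assumes "x \<in> uball M" "y \<in> uball L"
  shows "x + y \<in> uball (M + L)"
proof (rule uballI)
  fix A :: "nat set" assume "finite A"
  have "norm (\<Sum>n\<in>A. coord (x + y) n *\<^sub>R e n)
      = norm ((\<Sum>n\<in>A. coord x n *\<^sub>R e n) + (\<Sum>n\<in>A. coord y n *\<^sub>R e n))"
    by (simp add: coord_add scaleR_add_left sum.distrib)
  also have "\<dots> \<le> M + L"
    using uballD[OF assms(1) \<open>finite A\<close>] uballD[OF assms(2) \<open>finite A\<close>]
    by (intro norm_triangle_le) simp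
  finally show "norm (\<Sum>n\<in>A. coord (x + y) n *\<^sub>R e n) \<le> M + L" .
qed

text \<open>The sets \<open>uball n\<close> exhaust the space, so by Baire one closure contains a
  ball around some \<open>a\<close>. Differences of members move this ball to the origin and double
  the bound; the extra 1 only keeps the constant positive if \<open>n = 0\<close>.\<close>

lemma ball_subset_closure_uball: "\<exists>M \<rho>. 0 < \<rho> \<and> 0 < M \<and> ball 0 \<rho> \<subseteq> closure (uball M)"
proof -
  have "(\<Union>n. closure (uball (real n))) = UNIV"
  proof -
    have "x \<in> (\<Union>n. uball (real n))" for x
    proof -
      obtain M where M: "\<And>A. finite A \<Longrightarrow> norm (\<Sum>n\<in>A. coord x n *\<^sub>R e n) \<le> M"
        using partial_sums_bounded by blast
      obtain n where "M \<le> real n"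
        using real_arch_simple by blast
      then have "x \<in> uball (real n)"
        using M by (intro uballI) (meson order_trans)
      then show ?thesis by blast
    qed
    then show ?thesis
      using closure_subset by blast
  qed
  then obtain n where "interior (closure (uball (real n))) \<noteq> {}"
    using Baire_union_interior[of "\<lambda>n. closure (uball (real n))"] by auto
  then obtain a \<rho> where \<rho>: "0 < \<rho>" and ball: "ball a \<rho> \<subseteq> closure (uball (real n))"
    by (meson ex_in_conv mem_interior)
  have "ball 0 \<rho> \<subseteq> closure (uball (2 * real n + 1))"
  proof
    fix x :: 'a assume x: "x \<in> ball 0 \<rho>"
    show "x \<in> closure (uball (2 * real n + 1))"
      unfolding closure_approachable
    proof (intro allI impI)
      fix \<delta> :: real assume "0 < \<delta>"
      have "a + x \<in> closure (uball (real n))" "a \<in> closure (uball (real n))"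
        using x \<rho> ball by (auto simp: subset_iff dist_norm)
      then obtain u v where uv: "u \<in> uball (real n)" "v \<in> uball (real n)"
        "dist u (a + x) < \<delta> / 2" "dist v a < \<delta> / 2"
        unfolding closure_approachable using \<open>0 < \<delta>\<close> by (meson half_gt_zero)
      have "u + (-1) *\<^sub>R v \<in> uball (real n + \<bar>-1\<bar> * real n)"
        using uv by (intro add_uball scaleR_uball)
      then have "u - v \<in> uball (2 * real n + 1)"
        unfolding uball_def by (auto intro: order_trans)
      moreover have "dist (u - v) x < \<delta>"
      proof -
        have eq: "u - v - x = (u - (a + x)) - (v - a)"
          by simp
        show ?thesis
          using uv(3,4) norm_triangle_ineq4[of "u - (a + x)" "v - a"]
          unfolding dist_norm eq by linarith
      qed
      ultimately show "\<exists>y\<in>uball (2 * real n + 1). dist y x < \<delta>"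
        by blast
    qed
  qed
  with \<rho> show ?thesis
    by (intro exI[of _ "2 * real n + 1"] exI[of _ \<rho>]) auto
qed

text \<open>The successive approximation of the open mapping theorem: every small vector is a series of
  vectors with geometrically decreasing bounds, and the bounds add up coordinatewise.\<close>

lemma suminf_uball:
  assumes y: "\<And>k. y k \<in> uball (M / 2 ^ k)" and "y sums x" and "0 \<le> M"
  shows "x \<in> uball (2 * M)"
proof -
  have geom: "(\<lambda>k. M / 2 ^ k) sums (2 * M)"
    using sums_mult[OF geometric_sums[of "1/2::real"], of M]
    by (simp add: power_one_over mult.commute)
  have bnd: "\<bar>coord (y k) n\<bar> \<le> (1 / norm (e n)) * (M / 2 ^ k)" for k n
    using uballD[OF y, of "{n}" k] basis_nonzero[of n] by (simp add: field_simps)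
  have summ: "summable (\<lambda>k. coord (y k) n)" for n
    by (rule summable_comparison_test[OF _ summable_mult[OF sums_summable[OF geom], of "1 / norm (e n)"]])
       (use bnd[of _ n] in auto)
  \<comment> \<open>The candidate expansion of \<open>x\<close>. As the coordinates are not yet
    known to be continuous, \<open>coord x = a\<close> cannot be had by passing to the limit; it
    follows from uniqueness once the expansion with coefficients \<open>a\<close> is shown to
    converge to \<open>x\<close>.\<close>
  define a where "a n = (\<Sum>k. coord (y k) n)" for n
  have lim_a: "(\<lambda>m. \<Sum>k<m. coord (y k) n) \<longlonglongrightarrow> a n" for n
    using summ[of n] unfolding a_def by (simp add: summable_LIMSEQ)
  define Y where "Y m = (\<Sum>k<m. y k)" for m
  have Ylim: "Y \<longlonglongrightarrow> x"
    using \<open>y sums x\<close> by (simp add: sums_def Y_def[abs_def])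
  have coordY: "coord (Y m) n = (\<Sum>k<m. coord (y k) n)" for m n
    by (simp add: Y_def coord_sum)
  define tl where "tl m = 2 * M - (\<Sum>k<m. M / 2 ^ k)" for m
  have tl0: "tl \<longlonglongrightarrow> 0"
    using tendsto_diff[OF tendsto_const[of "2*M"] geom[unfolded sums_def]] by (simp add: tl_def[abs_def])
  have diffY: "Y p - Y m \<in> uball (tl m)" if "m \<le> p" for p m
  proof (rule uballI)
    fix A :: "nat set" assume A: "finite A"
    have *: "Y p - Y m = (\<Sum>k=m..<p. y k)"
      using that unfolding Y_def by (metis lessThan_atLeast0 sum_diff_nat_ivl zero_le)
    have "(\<Sum>n\<in>A. coord (Y p - Y m) n *\<^sub>R e n) = (\<Sum>k=m..<p. \<Sum>n\<in>A. coord (y k) n *\<^sub>R e n)"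
      by (simp add: * coord_sum scaleR_sum_left) (rule sum.swap)
    also have "norm \<dots> \<le> (\<Sum>k=m..<p. M / 2 ^ k)"
      by (intro sum_norm_le uballD[OF y A])
    also have "\<dots> \<le> tl m"
    proof -
      have "(\<Sum>k=m..<p. M / 2 ^ k) = (\<Sum>k<p. M / 2 ^ k) - (\<Sum>k<m. M / 2 ^ k)"
        using that by (metis lessThan_atLeast0 sum_diff_nat_ivl zero_le)
      also have "(\<Sum>k<p. M / 2 ^ k) \<le> 2 * M"
        using sum_le_suminf[OF sums_summable[OF geom], of "{..<p}"] \<open>0 \<le> M\<close> sums_unique[OF geom] by simp
      finally show ?thesis by (simp add: tl_def)
    qed
    finally show "norm (\<Sum>n\<in>A. coord (Y p - Y m) n *\<^sub>R e n) \<le> tl m" .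
  qed
  \<comment> \<open>Let \<open>p\<close> tend to infinity in \<open>diffY\<close>: for a fixed
    finite \<open>A\<close> only finitely many real sequences are involved. The bound is uniform in
    \<open>A\<close>, which allows choosing \<open>m\<close> first and the length of the partial sum
    afterwards. The case \<open>m = 0\<close> is the final estimate, since \<open>Y 0 = 0\<close>
    and \<open>tl 0 = 2 * M\<close>.\<close>
  have partial: "norm (\<Sum>n\<in>A. (a n - coord (Y m) n) *\<^sub>R e n) \<le> tl m" if "finite A" for A m
  proof (rule tendsto_upperbound)
    show "(\<lambda>p. norm (\<Sum>n\<in>A. (coord (Y p) n - coord (Y m) n) *\<^sub>R e n))
        \<longlonglongrightarrow> norm (\<Sum>n\<in>A. (a n - coord (Y m) n) *\<^sub>R e n)"
      using lim_a unfolding coordY by (intro tendsto_intros)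
    have "norm (\<Sum>n\<in>A. (coord (Y p) n - coord (Y m) n) *\<^sub>R e n) \<le> tl m" if "m \<le> p" for p
      using uballD[OF diffY[OF that] \<open>finite A\<close>] coord_add[of "Y p - Y m" "Y m"]
      by (metis (no_types, lifting) add_diff_cancel diff_add_cancel sum.cong)
    then show "\<forall>\<^sub>F p in sequentially. norm (\<Sum>n\<in>A. (coord (Y p) n - coord (Y m) n) *\<^sub>R e n) \<le> tl m"
      by (auto simp: eventually_sequentially)
  qed simp
  have "(\<lambda>n. a n *\<^sub>R e n) sums x"
    unfolding sums_def LIMSEQ_iff
  proof (intro allI impI)
    fix \<delta> :: real assume "0 < \<delta>"
    then have "\<forall>\<^sub>F m in sequentially. dist (tl m) 0 < \<delta>/3 \<and> dist (Y m) x < \<delta>/3"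
      by (intro eventually_conj tendstoD[OF tl0] tendstoD[OF Ylim]) auto
    then obtain m where m: "\<bar>tl m\<bar> < \<delta>/3" "norm (Y m - x) < \<delta>/3"
      by (auto simp: eventually_sequentially dist_norm)
    obtain p0 where p0: "\<And>p. p \<ge> p0 \<Longrightarrow> norm ((\<Sum>n<p. coord (Y m) n *\<^sub>R e n) - Y m) < \<delta>/3"
      using sums_coord[of "Y m"] \<open>0 < \<delta>\<close> unfolding sums_def LIMSEQ_iff by (metis zero_less_divide_iff zero_less_numeral)
    have "norm ((\<Sum>n<p. a n *\<^sub>R e n) - x) < \<delta>" if "p \<ge> p0" for p
    proof -
      have "(\<Sum>n<p. a n *\<^sub>R e n) - x = (\<Sum>n<p. (a n - coord (Y m) n) *\<^sub>R e n)
          + ((\<Sum>n<p. coord (Y m) n *\<^sub>R e n) - Y m) + (Y m - x)"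
        by (simp add: scaleR_diff_left sum_subtractf)
      also have "norm \<dots> \<le> norm (\<Sum>n<p. (a n - coord (Y m) n) *\<^sub>R e n)
          + norm ((\<Sum>n<p. coord (Y m) n *\<^sub>R e n) - Y m) + norm (Y m - x)"
        by (intro norm_triangle_le add_mono order_refl)
      also have "\<dots> < \<delta>/3 + \<delta>/3 + \<delta>/3"
        using partial[of "{..<p}" m] m p0[OF that] by simp
      finally show ?thesis by simp
    qed
    then show "\<exists>no. \<forall>n\<ge>no. norm ((\<Sum>n<n. a n *\<^sub>R e n) - x) < \<delta>"
      by blast
  qed
  then have "coord x = a"
    by (rule coord_eqI)
  moreover have "coord 0 n = 0" for n
    using coord_scaleR[of 0 0 n] by simp
  ultimately show ?thesis
    using partial[of _ 0] by (intro uballI) (simp add: tl_def Y_def)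
qed

text \<open>Density of \<open>uball M\<close> in a ball allows approximating \<open>x\<close> up to
  half the radius; rescaling by powers of 2 and correcting the remainders repeatedly writes
  \<open>x\<close> as a series to which \<open>suminf_uball\<close> applies. This removes the
  closure, and homogeneity gives the linear bound.\<close>

lemma unconditional_constant:
  "\<exists>K>0. \<forall>x A. finite A \<longrightarrow> norm (\<Sum>n\<in>A. coord x n *\<^sub>R e n) \<le> K * norm x"
proof -
  obtain M \<rho> where \<rho>: "0 < \<rho>" and M: "0 < M" and sub: "ball 0 \<rho> \<subseteq> closure (uball M)"
    using ball_subset_closure_uball by blast
  have step: "\<exists>y\<in>uball (M / 2 ^ k). norm (x - y) < \<rho> / 2 ^ Suc k" if "norm x < \<rho> / 2 ^ k" for x k
  proof -
    have "2 ^ k *\<^sub>R x \<in> closure (uball M)"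
      using that sub by (intro subsetD[OF sub]) (simp add: field_simps)
    then obtain u where u: "u \<in> uball M" "dist u (2 ^ k *\<^sub>R x) < \<rho> / 2"
      unfolding closure_approachable using \<rho> by (meson half_gt_zero)
    have "x - (1 / 2 ^ k) *\<^sub>R u = (1 / 2 ^ k) *\<^sub>R (2 ^ k *\<^sub>R x - u)"
      by (simp add: scaleR_diff_right)
    then have "norm (x - (1 / 2 ^ k) *\<^sub>R u) = (1 / 2 ^ k) * norm (2 ^ k *\<^sub>R x - u)"
      by simp
    also have "\<dots> < (1 / 2 ^ k) * (\<rho> / 2)"
      using u(2) by (intro mult_strict_left_mono) (auto simp: dist_norm norm_minus_commute)
    finally have "norm (x - (1 / 2 ^ k) *\<^sub>R u) < \<rho> / 2 ^ Suc k"
      by simp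
    moreover have "(1 / 2 ^ k) *\<^sub>R u \<in> uball (M / 2 ^ k)"
      using scaleR_uball[OF u(1), of "1 / 2 ^ k"] by simp
    ultimately show ?thesis
      by blast
  qed
  have small: "x \<in> uball (2 * M)" if "norm x < \<rho>" for x
  proof -
    have "\<exists>r. r 0 = x \<and> (\<forall>k. norm (r k) < \<rho> / 2 ^ k \<and> r k - r (Suc k) \<in> uball (M / 2 ^ k))"
    proof -
      have "\<exists>r. \<forall>k. (norm (r k) < \<rho> / 2 ^ k \<and> (k = 0 \<longrightarrow> r k = x)) \<and> r k - r (Suc k) \<in> uball (M / 2 ^ k)"
      proof (rule dependent_nat_choice)
        show "\<exists>r. norm r < \<rho> / 2 ^ 0 \<and> (0 = (0::nat) \<longrightarrow> r = x)"
          using that by auto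
        fix r k assume "norm r < \<rho> / 2 ^ k \<and> (k = 0 \<longrightarrow> r = x)"
        then obtain y where "y \<in> uball (M / 2 ^ k)" "norm (r - y) < \<rho> / 2 ^ Suc k"
          using step by blast
        then show "\<exists>r'. (norm r' < \<rho> / 2 ^ Suc k \<and> (Suc k = 0 \<longrightarrow> r' = x)) \<and> r - r' \<in> uball (M / 2 ^ k)"
          by (intro exI[of _ "r - y"]) auto
      qed
      then show ?thesis by blast
    qed
    then obtain r where r: "r 0 = x" "\<And>k. norm (r k) < \<rho> / 2 ^ k" "\<And>k. r k - r (Suc k) \<in> uball (M / 2 ^ k)"
      by blast
    have "(\<lambda>k. \<rho> * (1/2) ^ k) \<longlonglongrightarrow> 0"
      by (intro tendsto_mult_right_zero LIMSEQ_power_zero) auto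
    moreover have "norm (r k) \<le> \<rho> * (1/2) ^ k" for k
      using r(2)[of k] by (simp add: power_one_over)
    ultimately have "r \<longlonglongrightarrow> 0"
      by (intro Lim_null_comparison[of r "\<lambda>k. \<rho> * (1/2) ^ k"] always_eventually) auto
    then have "(\<lambda>k. r k - r (Suc k)) sums (r 0 - 0)"
      by (rule telescope_sums')
    then show ?thesis
      using suminf_uball[of "\<lambda>k. r k - r (Suc k)" M x] r M by simp
  qed
  show ?thesis
  proof (intro exI[of _ "4 * M / \<rho>"] conjI allI impI)
    show "0 < 4 * M / \<rho>" using M \<rho> by simp
    fix x and A :: "nat set" assume A: "finite A"
    show "norm (\<Sum>n\<in>A. coord x n *\<^sub>R e n) \<le> 4 * M / \<rho> * norm x"
    proof (cases "x = 0")
      case True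
      then show ?thesis using coord_scaleR[of 0 0] by simp
    next
      case False
      \<comment> \<open>Scaling \<open>x\<close> to norm \<open>\<rho> / 2\<close> puts it strictly
        inside the ball, and \<open>2 * M / c\<close> is the claimed bound
        \<open>4 * M / \<rho> * norm x\<close>.\<close>
      define c where "c = \<rho> / (2 * norm x)"
      have c: "0 < c" using False \<rho> by (simp add: c_def)
      have "norm (c *\<^sub>R x) < \<rho>" using False \<rho> by (simp add: c_def)
      then have "norm (\<Sum>n\<in>A. coord (c *\<^sub>R x) n *\<^sub>R e n) \<le> 2 * M"
        using small uballD A by blast
      also have "(\<Sum>n\<in>A. coord (c *\<^sub>R x) n *\<^sub>R e n) = c *\<^sub>R (\<Sum>n\<in>A. coord x n *\<^sub>R e n)"
        by (simp add: coord_scaleR scaleR_sum_right)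
      finally show ?thesis
        using c False \<rho> by (simp add: c_def field_simps)
    qed
  qed
qed

definition K :: real where
  "K = (SOME K. 0 < K \<and> (\<forall>x A. finite A \<longrightarrow> norm (\<Sum>n\<in>A. coord x n *\<^sub>R e n) \<le> K * norm x))"

lemma K_props: "0 < K \<and> (\<forall>x A. finite A \<longrightarrow> norm (\<Sum>n\<in>A. coord x n *\<^sub>R e n) \<le> K * norm x)"
  unfolding K_def by (rule someI_ex) (use unconditional_constant in blast)

lemma K_pos: "0 < K"
  using K_props by blast

lemma norm_partial_sum_le: "finite A \<Longrightarrow> norm (\<Sum>n\<in>A. coord x n *\<^sub>R e n) \<le> K * norm x"
  using K_props by blast

lemma norm_multiplier_le:
  assumes "finite A" and "\<And>n. n \<in> A \<Longrightarrow> 0 \<le> \<theta> n \<and> \<theta> n \<le> 1"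
  shows "norm (\<Sum>n\<in>A. (\<theta> n * coord x n) *\<^sub>R e n) \<le> K * norm x"
  using norm_sum_scaleR_le_of_subsets[of A \<theta> 0 "\<lambda>n. coord x n *\<^sub>R e n" "K * norm x", OF assms]
    norm_partial_sum_le[OF finite_subset[OF _ assms(1)], of _ x] by simp

text \<open>After division by \<open>b\<close> the positive and the negative part of
  \<open>\<theta>\<close> are multipliers with values in [0,1]; treating them separately costs the
  factor 2.\<close>

lemma norm_signed_multiplier_le:
  assumes "finite A" and "0 \<le> b" and "\<And>n. n \<in> A \<Longrightarrow> \<bar>\<theta> n\<bar> \<le> b"
  shows "norm (\<Sum>n\<in>A. (\<theta> n * coord x n) *\<^sub>R e n) \<le> 2 * b * K * norm x"
proof (cases "b = 0")
  case True
  then show ?thesis using assms by simp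
next
  case False
  then have b: "0 < b" using assms by simp
  define p where "p n = max (\<theta> n) 0 / b" for n
  define m where "m n = max (- \<theta> n) 0 / b" for n
  have "norm (\<Sum>n\<in>A. (\<theta> n * coord x n) *\<^sub>R e n)
      = norm (b *\<^sub>R (\<Sum>n\<in>A. (p n * coord x n) *\<^sub>R e n) - b *\<^sub>R (\<Sum>n\<in>A. (m n * coord x n) *\<^sub>R e n))"
  proof -
    have "\<theta> n * coord x n = b * (p n * coord x n) - b * (m n * coord x n)" for n
      using b by (auto simp: p_def m_def max_def)
    then show ?thesis
      by (simp add: scaleR_sum_right scaleR_diff_left sum_subtractf)
  qed
  also have "\<dots> \<le> b * norm (\<Sum>n\<in>A. (p n * coord x n) *\<^sub>R e n) + b * norm (\<Sum>n\<in>A. (m n * coord x n) *\<^sub>R e n)"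
    using b by (intro order_trans[OF norm_triangle_ineq4]) simp
  also have "\<dots> \<le> b * (K * norm x) + b * (K * norm x)"
  proof (intro add_mono mult_left_mono norm_multiplier_le assms(1))
    fix n assume "n \<in> A"
    then have "max (\<theta> n) 0 \<le> b" "max (- \<theta> n) 0 \<le> b"
      using assms(3)[of n] assms(2) by auto
    then show "0 \<le> p n \<and> p n \<le> 1" "0 \<le> m n \<and> m n \<le> 1"
      using b by (auto simp: p_def m_def)
  qed (use b in auto)
  finally show ?thesis by (simp add: algebra_simps)
qed

section \<open>Continuous coordinates, tails and separability\<close>

lemma bounded_linear_coord: "bounded_linear (\<lambda>x. coord x n)"
proof (rule bounded_linear_intro[where K = "K / norm (e n)"])
  show "norm (coord x n) \<le> norm x * (K / norm (e n))" for x
    using norm_partial_sum_le[of "{n}" x] basis_nonzero[of n]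
    by (simp add: pos_le_divide_eq mult.commute)
qed (auto simp: coord_add coord_scaleR)

lift_definition coordL :: "nat \<Rightarrow> 'a \<Rightarrow>\<^sub>L real" is "\<lambda>n x. coord x n"
  by (rule bounded_linear_coord)

lemma coord_basis: "coord (e k) n = (if n = k then 1 else 0)"
proof -
  have "coord (e k) = (\<lambda>n. if n = k then 1 else 0)"
    by (rule coord_eqI) (use sums_single[of k "\<lambda>_. e k"] in
      \<open>simp add: if_distrib[of "\<lambda>c. c *\<^sub>R _"] cong: if_cong\<close>)
  then show ?thesis by simp
qed

definition tail :: "nat \<Rightarrow> 'a \<Rightarrow> 'a" where
  "tail m x = x - (\<Sum>n<m. coord x n *\<^sub>R e n)"

lemma bounded_linear_tail: "bounded_linear (tail m)"
  unfolding tail_def [abs_def]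
  by (intro bounded_linear_sub bounded_linear_ident bounded_linear_sum
      bounded_linear_scaleR_left[THEN bounded_linear_compose, OF bounded_linear_coord])

lift_definition tailL :: "nat \<Rightarrow> 'a \<Rightarrow>\<^sub>L 'a" is tail
  by (rule bounded_linear_tail)

lemma norm_tail_le: "norm (tail m x) \<le> (1 + K) * norm x"
  using norm_partial_sum_le[of "{..<m}" x] norm_triangle_ineq4[of x "\<Sum>n<m. coord x n *\<^sub>R e n"]
  by (simp add: tail_def algebra_simps)

lemma tail_tendsto_0: "(\<lambda>m. tail m x) \<longlonglongrightarrow> 0"
  using tendsto_diff[OF tendsto_const[of x] sums_coord[of x, unfolded sums_def]]
  by (simp add: tail_def)

lemma coord_tail: "coord (tail m x) n = (if m \<le> n then coord x n else 0)"
proof -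
  have "coord x n = coord (tail m x) n + (\<Sum>k<m. coord x k * coord (e k) n)"
    using coord_add[of "tail m x" "\<Sum>n<m. coord x n *\<^sub>R e n" n]
    by (simp add: tail_def coord_sum coord_scaleR)
  also have "(\<Sum>k<m. coord x k * coord (e k) n) = (if m \<le> n then 0 else coord x n)"
    by (auto simp: coord_basis if_distrib[of "\<lambda>c. _ * c"] cong: if_cong)
  finally show ?thesis by (auto split: if_splits)
qed

lemma countable_dense: "\<exists>D::'a set. countable D \<and> closure D = UNIV"
proof -
  define v :: "rat list \<Rightarrow> 'a" where "v qs = (\<Sum>i<length qs. real_of_rat (qs ! i) *\<^sub>R e i)" for qs
  have "x \<in> closure (range v)" for x
    unfolding closure_approachable
  proof (intro allI impI)
    fix \<delta> :: real assume "0 < \<delta>"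
    obtain m where m: "norm (tail m x) < \<delta> / 2"
      using tendstoD[OF tail_tendsto_0, of "\<delta>/2" x] \<open>0 < \<delta>\<close>
      by (auto simp: eventually_sequentially)
    have "\<exists>q. \<bar>real_of_rat q - coord x i\<bar> * norm (e i) < \<delta> / (2 * (m + 1))" for i
    proof -
      have "0 < \<delta> / (2 * (m + 1)) / norm (e i)"
        using \<open>0 < \<delta>\<close> basis_nonzero by simp
      then obtain q where "coord x i < real_of_rat q" "real_of_rat q < coord x i + \<delta> / (2 * (m + 1)) / norm (e i)"
        using of_rat_dense[of "coord x i" "coord x i + \<delta> / (2 * (m + 1)) / norm (e i)"] by auto
      then have "\<bar>real_of_rat q - coord x i\<bar> < \<delta> / (2 * (m + 1)) / norm (e i)"
        by auto
      then show ?thesis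
        using basis_nonzero[of i] by (intro exI[of _ q]) (simp only: pos_less_divide_eq zero_less_norm_iff simp_thms)
    qed
    then obtain q where q: "\<And>i. \<bar>real_of_rat (q i) - coord x i\<bar> * norm (e i) < \<delta> / (2 * (m + 1))"
      by metis
    have "v (map q [0..<m]) - x = (\<Sum>i<m. (real_of_rat (q i) - coord x i) *\<^sub>R e i) - tail m x"
      by (simp add: v_def tail_def scaleR_diff_left sum_subtractf)
    also have "norm \<dots> \<le> (\<Sum>i<m. \<delta> / (2 * (m + 1))) + norm (tail m x)"
      by (intro order_trans[OF norm_triangle_ineq4] add_mono sum_norm_le order_refl)
         (use q in \<open>simp add: less_imp_le\<close>)
    also have "\<dots> < \<delta>"
    proof -
      have "(\<Sum>i<m. \<delta> / (2 * (m + 1))) \<le> \<delta> / 2"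
        using \<open>0 < \<delta>\<close> by (simp add: field_simps)
      then show ?thesis using m by linarith
    qed
    finally show "\<exists>y\<in>range v. dist y x < \<delta>"
      by (auto simp: dist_norm)
  qed
  then show ?thesis
    by (intro exI[of _ "range v"]) auto
qed

end

section \<open>Operators vanishing on kernels of finitely many functionals\<close>

text \<open>Equivalently, \<open>A\<close> is a finite sum of rank-one operators, each given by a
  functional in \<open>W\<close> times a fixed vector. Stating it with kernels makes sums and
  compositions easy, and for countable \<open>W\<close> only countably many sets \<open>S\<close>
  have to be considered.\<close>

definition vanishes_on_kernel :: "('a::real_normed_vector \<Rightarrow>\<^sub>L real) set \<Rightarrow> ('a \<Rightarrow>\<^sub>L 'b::real_normed_vector) \<Rightarrow> bool"
  where "vanishes_on_kernel W A \<longleftrightarrow>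
    (\<exists>S. finite S \<and> S \<subseteq> W \<and> (\<forall>v. (\<forall>L\<in>S. blinfun_apply L v = 0) \<longrightarrow> blinfun_apply A v = 0))"

lemma vanishes_on_kernelI:
  "finite S \<Longrightarrow> S \<subseteq> W \<Longrightarrow> (\<And>v. (\<And>L. L \<in> S \<Longrightarrow> blinfun_apply L v = 0) \<Longrightarrow> blinfun_apply A v = 0)
    \<Longrightarrow> vanishes_on_kernel W A"
  unfolding vanishes_on_kernel_def by (intro exI[of _ S]) simp

lemma vanishes_on_kernel_mono:
  "vanishes_on_kernel W A \<Longrightarrow> W \<subseteq> W' \<Longrightarrow> vanishes_on_kernel W' A"
  unfolding vanishes_on_kernel_def by (meson subset_trans)

lemma vanishes_on_kernel_of_finite:
  assumes "finite I" and "\<And>i. i \<in> I \<Longrightarrow> vanishes_on_kernel W (B i)"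
    and "\<And>v. (\<And>i. i \<in> I \<Longrightarrow> blinfun_apply (B i) v = 0) \<Longrightarrow> blinfun_apply A v = 0"
  shows "vanishes_on_kernel W A"
proof -
  have "\<forall>i\<in>I. \<exists>S. finite S \<and> S \<subseteq> W \<and>
      (\<forall>v. (\<forall>L\<in>S. blinfun_apply L v = 0) \<longrightarrow> blinfun_apply (B i) v = 0)"
    using assms(2) unfolding vanishes_on_kernel_def by blast
  from bchoice[OF this] obtain S where S: "\<forall>i\<in>I. finite (S i) \<and> S i \<subseteq> W \<and>
      (\<forall>v. (\<forall>L\<in>S i. blinfun_apply L v = 0) \<longrightarrow> blinfun_apply (B i) v = 0)"
    ..
  show ?thesis
  proof (rule vanishes_on_kernelI)
    show "finite (\<Union>i\<in>I. S i)" "(\<Union>i\<in>I. S i) \<subseteq> W"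
      using S assms(1) by auto
    show "blinfun_apply A v = 0" if "\<And>L. L \<in> (\<Union>i\<in>I. S i) \<Longrightarrow> blinfun_apply L v = 0" for v
      using S that by (intro assms(3)) (meson UN_I)
  qed
qed

lemma vanishes_on_kernel_member: "A \<in> W \<Longrightarrow> vanishes_on_kernel W A"
  by (rule vanishes_on_kernelI[of "{A}"]) auto

lemma vanishes_on_kernel_zero: "vanishes_on_kernel W 0"
  by (rule vanishes_on_kernelI[of "{}"]) auto

lemma vanishes_on_kernel_trans:
  assumes "vanishes_on_kernel W B"
    and "\<And>v. blinfun_apply B v = 0 \<Longrightarrow> blinfun_apply A v = 0"
  shows "vanishes_on_kernel W A"
  using assms unfolding vanishes_on_kernel_def by blast

lemma vanishes_on_kernel_add:
  assumes "vanishes_on_kernel W A" "vanishes_on_kernel W B"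
  shows "vanishes_on_kernel W (A + B)"
proof (rule vanishes_on_kernel_of_finite)
  show "finite (UNIV :: bool set)"
    by simp
  show "vanishes_on_kernel W (if i then A else B)" for i
    using assms by simp
  show "blinfun_apply (A + B) v = 0"
    if *: "\<And>i. i \<in> UNIV \<Longrightarrow> blinfun_apply (if i then A else B) v = 0" for v
    using *[of True] *[of False] by (simp add: blinfun.add_left)
qed

lemma vanishes_on_kernel_sum:
  "finite I \<Longrightarrow> (\<And>i. i \<in> I \<Longrightarrow> vanishes_on_kernel W (A i)) \<Longrightarrow> vanishes_on_kernel W (sum A I)"
  by (induction I rule: finite_induct) (auto intro: vanishes_on_kernel_zero vanishes_on_kernel_add)

lemma vanishes_on_kernel_scaleR:
  "vanishes_on_kernel W A \<Longrightarrow> vanishes_on_kernel W (c *\<^sub>R A)"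
  by (erule vanishes_on_kernel_trans) (simp add: blinfun.scaleR_left)

lemma vanishes_on_kernel_compose_left:
  "vanishes_on_kernel W A \<Longrightarrow> vanishes_on_kernel W (B o\<^sub>L A)"
  by (erule vanishes_on_kernel_trans) (simp add: blinfun.zero_right)

text \<open>Composition on the right changes the functionals. This is the reason why
  \<open>kernel_functionals\<close> contains the composites of \<open>W\<close> with every tail
  operator.\<close>

lemma vanishes_on_kernel_compose_right:
  assumes "vanishes_on_kernel W A"
  shows "vanishes_on_kernel ((\<lambda>L. L o\<^sub>L R) ` W) (A o\<^sub>L R)"
proof -
  obtain S where S: "finite S" "S \<subseteq> W"
    "\<forall>v. (\<forall>L\<in>S. blinfun_apply L v = 0) \<longrightarrow> blinfun_apply A v = 0"
    using assms unfolding vanishes_on_kernel_def by auto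
  show ?thesis
  proof (rule vanishes_on_kernelI[of "(\<lambda>L. L o\<^sub>L R) ` S"])
    show "blinfun_apply (A o\<^sub>L R) v = 0"
      if "\<And>L. L \<in> (\<lambda>L. L o\<^sub>L R) ` S \<Longrightarrow> blinfun_apply L v = 0" for v
      using S(3)[rule_format, of "blinfun_apply R v"] that by force
  qed (use S in auto)
qed

section \<open>Tools: derivatives along lines, countable subcovers, locally finite sums, a smooth
  step\<close>

lemma has_derivative_directional:
  fixes f :: "'a::real_normed_vector \<Rightarrow> real"
  assumes "(f has_derivative f') (at x)"
  shows "((\<lambda>t. f (x + t *\<^sub>R v)) has_real_derivative f' v) (at 0)"
proof -
  have "((\<lambda>t. f (x + t *\<^sub>R v)) has_derivative (\<lambda>t. f' (t *\<^sub>R v))) (at 0)"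
    using assms by (auto intro!: derivative_eq_intros has_derivative_compose[of "\<lambda>t. x + t *\<^sub>R v" _ _ _ f])
  moreover have "(\<lambda>t. f' (t *\<^sub>R v)) = (*) (f' v)"
    using linear_scale[OF has_derivative_linear[OF assms]] by (auto simp: mult.commute)
  ultimately show ?thesis
    by (simp add: has_field_derivative_def)
qed

lemma has_derivative_Lipschitz_bound:
  fixes f :: "'a::real_normed_vector \<Rightarrow> real"
  assumes "(f has_derivative f') (at x)" and "\<And>y. \<bar>f y - f x\<bar> \<le> C * norm (y - x)"
  shows "\<bar>f' v\<bar> \<le> C * norm v"
proof (rule tendsto_upperbound)
  show "((\<lambda>h. \<bar>(f (x + h *\<^sub>R v) - f x) / h\<bar>) \<longlongrightarrow> \<bar>f' v\<bar>) (at 0)"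
    using has_derivative_directional[OF assms(1), of v] unfolding DERIV_def
    by (intro tendsto_rabs) simp
  have "\<bar>(f (x + h *\<^sub>R v) - f x) / h\<bar> \<le> C * norm v" if "h \<noteq> 0" for h
    using assms(2)[of "x + h *\<^sub>R v"] that by (simp add: abs_divide field_simps)
  then show "\<forall>\<^sub>F h in at 0. \<bar>(f (x + h *\<^sub>R v) - f x) / h\<bar> \<le> C * norm v"
    by (auto simp: eventually_at intro!: exI[of _ 1])
qed simp

text \<open>Turns local dependence on finitely many functionals into vanishing of the derivative on
  their common kernel, without any regularity of the function \<open>\<gamma>\<close> that expresses
  this dependence.\<close>

lemma has_derivative_zero_of_local_const:
  fixes f :: "'a::real_normed_vector \<Rightarrow> real"
  assumes "(f has_derivative f') (at x)" and "open V" "x \<in> V"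
    and const: "\<And>t. x + t *\<^sub>R v \<in> V \<Longrightarrow> f (x + t *\<^sub>R v) = f x"
  shows "f' v = 0"
proof -
  have "open ((\<lambda>t. x + t *\<^sub>R v) -` V)"
    by (intro open_vimage \<open>open V\<close> continuous_intros)
  moreover have "0 \<in> (\<lambda>t. x + t *\<^sub>R v) -` V"
    using \<open>x \<in> V\<close> by simp
  ultimately have "((\<lambda>t. f (x + t *\<^sub>R v)) has_real_derivative 0) (at 0)"
    using const by (intro DERIV_const[of "f x", THEN has_field_derivative_transform_within_open]) auto
  then show ?thesis
    using DERIV_unique has_derivative_directional[OF assms(1)] by blast
qed

text \<open>A Lindelof argument: there are countably many balls with centre in \<open>D\<close> and
  radius \<open>1 / (n + 1)\<close>, and for each one that fits into some \<open>V x\<close> a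
  single such \<open>x\<close> is kept. The chosen point need not be near the points being covered;
  it only matters that its \<open>V\<close> contains the ball.\<close>

lemma countable_subcover_of_dense:
  fixes D :: "'a::metric_space set"
    and V :: "'a \<Rightarrow> 'a set"
  assumes D: "countable D" "closure D = UNIV" and Vx: "\<And>x. x \<in> U \<Longrightarrow> open (V x) \<and> x \<in> V x"
  shows "\<exists>C. countable C \<and> C \<subseteq> U \<and> U \<subseteq> (\<Union>x\<in>C. V x)"
proof -
  define P where "P d n x \<longleftrightarrow> x \<in> U \<and> ball d (inverse (real (Suc n))) \<subseteq> V x" for d n x
  define I where "I = {(d, n). d \<in> D \<and> (\<exists>x. P d n x)}"
  define c where "c = (\<lambda>(d, n). SOME x. P d n x)"
  have "I \<subseteq> D \<times> UNIV" by (auto simp: I_def)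
  then have "countable I"
    using D(1) countable_subset by (metis countable_SIGMA countableI_type)
  have c: "P d n (c (d, n))" if "(d, n) \<in> I" for d n
    using that unfolding I_def c_def by (auto intro: someI_ex)
  have "x \<in> (\<Union>y\<in>c ` I. V y)" if xU: "x \<in> U" for x
  proof -
    obtain r where r: "r > 0" "ball x r \<subseteq> V x"
      using Vx[OF xU] by (meson open_contains_ball)
    obtain n where n: "inverse (real (Suc n)) < r / 2"
      using r reals_Archimedean[of "r/2"] by auto
    have "x \<in> closure D"
      using D by simp
    then obtain d where d: "d \<in> D" "dist d x < inverse (real (Suc n))"
      unfolding closure_approachable by (metis inverse_positive_iff_positive of_nat_0_less_iff zero_less_Suc)
    have "ball d (inverse (real (Suc n))) \<subseteq> ball x r"
    proof
      fix y assume "y \<in> ball d (inverse (real (Suc n)))"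
      then have "dist d y < r / 2" "dist d x < r / 2"
        using d n by auto
      then show "y \<in> ball x r"
        using dist_triangle2[of x y d] by (simp add: dist_commute)
    qed
    then have "P d n x"
      using r xU by (auto simp: P_def)
    then have "(d, n) \<in> I"
      using d by (auto simp: I_def)
    moreover have "x \<in> V (c (d, n))"
      using c[OF \<open>(d, n) \<in> I\<close>] d by (auto simp: P_def)
    ultimately show ?thesis by blast
  qed
  moreover have "c ` I \<subseteq> U"
    using c by (auto simp: P_def)
  ultimately show ?thesis
    using \<open>countable I\<close> by (intro exI[of _ "c ` I"]) auto
qed

text \<open>Near each point both series are finite sums with a common length, so differentiation is
  termwise. In the last clause \<open>m\<close> may be any cutoff valid at the single point
  \<open>x\<close>; this flexibility is used for \<open>\<Psi>\<close> and for the gluing.\<close>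

lemma C1_locally_finite_sum:
  fixes u :: "nat \<Rightarrow> 'a::real_normed_vector \<Rightarrow> 'b::real_normed_vector"
    and Du :: "nat \<Rightarrow> 'a \<Rightarrow> 'a \<Rightarrow>\<^sub>L 'b"
  assumes der: "\<And>n x. x \<in> U \<Longrightarrow> (u n has_derivative blinfun_apply (Du n x)) (at x)"
    and cont: "\<And>n. continuous_on U (Du n)"
    and fin: "\<And>x. x \<in> U \<Longrightarrow> \<exists>m V. open V \<and> x \<in> V \<and> V \<subseteq> U \<and> (\<forall>y\<in>V. \<forall>n\<ge>m. u n y = 0 \<and> Du n y = 0)"
  shows "\<exists>g Dg. (\<forall>x\<in>U. (g has_derivative blinfun_apply (Dg x)) (at x)) \<and> continuous_on U Dg \<and>
    (\<forall>x\<in>U. \<forall>m. (\<forall>n\<ge>m. u n x = 0 \<and> Du n x = 0) \<longrightarrow> g x = (\<Sum>n<m. u n x) \<and> Dg x = (\<Sum>n<m. Du n x))"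
proof -
  define g where "g x = (\<Sum>n. u n x)" for x
  define Dg where "Dg x = (\<Sum>n. Du n x)" for x
  have eq: "g x = (\<Sum>n<m. u n x)" "Dg x = (\<Sum>n<m. Du n x)"
    if "\<forall>n\<ge>m. u n x = 0 \<and> Du n x = 0" for x m
    unfolding g_def Dg_def using that by (auto simp: not_less intro!: suminf_finite intro: leI)
  have loc: "(g has_derivative blinfun_apply (Dg x)) (at x) \<and> continuous (at x) Dg" if x: "x \<in> U" for x
  proof -
    obtain m V where V: "open V" "x \<in> V" "V \<subseteq> U" and z: "\<And>y. y \<in> V \<Longrightarrow> \<forall>n\<ge>m. u n y = 0 \<and> Du n y = 0"
      using fin[OF x] by blast
    have "((\<lambda>y. \<Sum>n<m. u n y) has_derivative (\<lambda>v. \<Sum>n<m. blinfun_apply (Du n x) v)) (at x)"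
      by (intro has_derivative_sum der x)
    then have "(g has_derivative (\<lambda>v. \<Sum>n<m. blinfun_apply (Du n x) v)) (at x)"
      by (rule has_derivative_transform_within_open[OF _ V(1,2)]) (simp add: eq(1)[OF z])
    moreover have "(\<lambda>v. \<Sum>n<m. blinfun_apply (Du n x) v) = blinfun_apply (Dg x)"
      using eq(2)[OF z[OF V(2)]] by (auto simp: blinfun.sum_left)
    moreover have "continuous_on V Dg"
    proof -
      have "continuous_on V (\<lambda>y. \<Sum>n<m. Du n y)"
        by (intro continuous_on_sum continuous_on_subset[OF cont V(3)])
      then show ?thesis
        using eq(2)[OF z] by (simp cong: continuous_on_cong)
    qed
    ultimately show ?thesis
      using V continuous_on_eq_continuous_at by fastforce
  qed
  then show ?thesis
    using eq by (intro exI[of _ g] exI[of _ Dg]) (auto simp: continuous_at_imp_continuous_on)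
qed

text \<open>The squared positive part \<open>q\<close> is C1, and
  \<open>q (t - 1) / (q (t - 1) + q (2 - t))\<close> has the required shape: the two squares never
  vanish together, so the denominator is positive. The derivative lives on the compact interval from
  1 to 2 and is therefore bounded.\<close>

lemma exists_C1_step:
  "\<exists>(\<psi>::real \<Rightarrow> real) \<psi>' M. (\<forall>t. (\<psi> has_real_derivative \<psi>' t) (at t)) \<and> continuous_on UNIV \<psi>' \<and>
     (\<forall>t\<le>1. \<psi> t = 0 \<and> \<psi>' t = 0) \<and> (\<forall>t\<ge>2. \<psi> t = 1 \<and> \<psi>' t = 0) \<and>
     (\<forall>t. 0 \<le> \<psi> t \<and> \<psi> t \<le> 1) \<and> 0 < M \<and> (\<forall>t. \<bar>\<psi>' t\<bar> \<le> M)"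
proof -
  define q :: "real \<Rightarrow> real" where "q t = (max 0 t)\<^sup>2" for t
  define p :: "real \<Rightarrow> real" where "p t = 2 * max 0 t" for t
  have q: "(q has_real_derivative p t) (at t)" for t
  proof -
    consider "t < 0" | "t = 0" | "t > 0" by linarith
    then show ?thesis
    proof cases
      case 1
      have "((\<lambda>_. 0) has_real_derivative p t) (at t)"
        using 1 by (simp add: p_def)
      then show ?thesis
        by (rule has_field_derivative_transform_within_open[of _ _ _ "{..<0}"]) (use 1 in \<open>auto simp: q_def\<close>)
    next
      case 3
      have "((\<lambda>s. s\<^sup>2) has_real_derivative p t) (at t)"
        using 3 by (auto intro!: derivative_eq_intros simp: p_def)
      then show ?thesis
        by (rule has_field_derivative_transform_within_open[of _ _ _ "{0<..}"]) (use 3 in \<open>auto simp: q_def\<close>)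
    next
      case 2
      have "((\<lambda>h. (q (0 + h) - q 0) / h) \<longlongrightarrow> 0) (at 0)"
      proof (rule Lim_null_comparison)
        have "\<bar>q h / h\<bar> \<le> \<bar>h\<bar>" for h
          by (cases "h > 0") (auto simp: q_def power2_eq_square max_def)
        then show "\<forall>\<^sub>F h in at 0. norm ((q (0 + h) - q 0) / h) \<le> \<bar>h\<bar>"
          by (auto simp: q_def)
        show "((\<lambda>h. \<bar>h\<bar>) \<longlongrightarrow> 0) (at (0::real))"
          using tendsto_rabs[OF tendsto_ident_at, of "0::real" UNIV] by simp
      qed
      then show ?thesis
        using 2 by (simp add: DERIV_def p_def)
    qed
  qed
  define d where "d t = q (t - 1) + q (2 - t)" for t
  have d: "d t > 0" for t
  proof -
    have "max 0 (t - 1) > 0 \<or> max 0 (2 - t) > 0" by auto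
    then show ?thesis
      unfolding d_def q_def by (metis add_nonneg_pos add_pos_nonneg zero_le_power2 zero_less_power)
  qed
  define \<psi> where "\<psi> t = q (t - 1) / d t" for t
  define \<psi>' where "\<psi>' t = (p (t - 1) * d t - q (t - 1) * (p (t - 1) - p (2 - t))) / (d t * d t)" for t
  have q1: "((\<lambda>t. q (t - 1)) has_real_derivative p (t - 1)) (at t)" for t
    using DERIV_shift[of q "p (t - 1)" t "-1"] q[of "t - 1"] by simp
  have q2: "((\<lambda>t. q (2 - t)) has_real_derivative - p (2 - t)) (at t)" for t
  proof -
    have "((\<lambda>t. 2 - t) has_real_derivative -1) (at t)"
      by (auto intro!: derivative_eq_intros)
    from DERIV_chain2[OF q this] show ?thesis by simp
  qed
  have der: "(\<psi> has_real_derivative \<psi>' t) (at t)" for t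
    unfolding \<psi>_def [abs_def] \<psi>'_def d_def[abs_def]
    by (rule DERIV_divide) (use d[of t] in \<open>auto intro!: derivative_eq_intros q1 q2 simp: d_def\<close>)
  have cont: "continuous_on UNIV \<psi>'"
    unfolding \<psi>'_def d_def p_def q_def
    by (intro continuous_intros) (use d in \<open>auto simp: d_def q_def less_imp_neq[symmetric]\<close>)
  have low: "\<psi> t = 0 \<and> \<psi>' t = 0" if "t \<le> 1" for t
    using that by (simp add: \<psi>_def \<psi>'_def q_def p_def)
  have high: "\<psi> t = 1 \<and> \<psi>' t = 0" if "t \<ge> 2" for t
    using that d[of t] by (simp add: \<psi>_def \<psi>'_def d_def q_def p_def)
  have range: "0 \<le> \<psi> t \<and> \<psi> t \<le> 1" for t
    using d[of t] by (simp add: \<psi>_def d_def q_def)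
  have "bounded (\<psi>' ` {1..2})"
    by (intro compact_imp_bounded compact_continuous_image continuous_on_subset[OF cont]) auto
  then obtain M where "0 < M" and M: "\<And>t. t \<in> {1..2} \<Longrightarrow> \<bar>\<psi>' t\<bar> \<le> M"
    unfolding bounded_pos by auto
  then have bound: "\<bar>\<psi>' t\<bar> \<le> M" for t
    using low[of t] high[of t] M[of t] by (cases "t \<le> 1"; cases "t \<ge> 2") auto
  show ?thesis
    by (intro exI[of _ \<psi>] exI[of _ \<psi>'] exI[of _ M] conjI allI impI)
       (simp_all add: der cont low high range \<open>0 < M\<close> bound)
qed

section \<open>Smooth bumps and functionals in general position\<close>

text \<open>Countably many of the neighbourhoods on which \<open>N\<close> depends on a finite list
  of functionals cover the complement of 0. For \<open>z\<close> in such a neighbourhood of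
  \<open>a\<close>, moving along the common kernel of the list of \<open>a\<close> leaves
  \<open>N\<close> locally constant, so \<open>N' z\<close> vanishes there.\<close>

lemma countable_functionals_of_locally_finite:
  fixes N :: "'a::real_normed_vector \<Rightarrow> real"
  assumes D: "countable (D :: 'a set)" "closure D = UNIV"
    and lfc: "locally_depends_on_finitely_many_coords N"
    and der: "\<And>z. z \<noteq> 0 \<Longrightarrow> (N has_derivative blinfun_apply (N' z)) (at z)"
  shows "\<exists>W. countable W \<and> (\<forall>z. z \<noteq> 0 \<longrightarrow> vanishes_on_kernel W (N' z))"
proof -
  define good where "good z V Ls \<longleftrightarrow> open V \<and> z \<in> V \<and>
      (\<exists>\<gamma> :: real list \<Rightarrow> real. \<forall>y\<in>V. N y = \<gamma> (map (\<lambda>L. blinfun_apply L y) Ls))"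
    for z :: 'a and V and Ls :: "('a \<Rightarrow>\<^sub>L real) list"
  have "\<exists>V Ls. good z V Ls" if "z \<noteq> 0" for z
    using lfc that unfolding locally_depends_on_finitely_many_coords_def good_def by meson
  then obtain V Ls where good: "\<And>z. z \<noteq> 0 \<Longrightarrow> good z (V z) (Ls z)"
    by metis
  then have V: "\<And>z. z \<in> -{0} \<Longrightarrow> open (V z) \<and> z \<in> V z"
    by (auto simp: good_def)
  obtain C where C: "countable C" "C \<subseteq> -{0}" "-{0} \<subseteq> (\<Union>x\<in>C. V x)"
    using countable_subcover_of_dense[OF D, of "-{0}" V] V by auto
  show ?thesis
  proof (intro exI[of _ "\<Union>x\<in>C. set (Ls x)"] conjI allI impI)
    show "countable (\<Union>x\<in>C. set (Ls x))"
      using C(1) by (intro countable_UN) (auto intro: countable_finite)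
    fix z :: 'a assume "z \<noteq> 0"
    then obtain a where a: "a \<in> C" "z \<in> V a"
      using C(3) by auto
    show "vanishes_on_kernel (\<Union>x\<in>C. set (Ls x)) (N' z)"
    proof (rule vanishes_on_kernelI[of "set (Ls a)"])
      fix v assume v: "\<And>L. L \<in> set (Ls a) \<Longrightarrow> blinfun_apply L v = 0"
      have eq: "map (\<lambda>L. blinfun_apply L (z + t *\<^sub>R v)) (Ls a) = map (\<lambda>L. blinfun_apply L z) (Ls a)" for t
        using v by (simp add: blinfun.add_right blinfun.scaleR_right)
      have a0: "a \<in> -{0}" using C a by blast
      then obtain \<gamma> :: "real list \<Rightarrow> real"
        where \<gamma>: "\<And>y. y \<in> V a \<Longrightarrow> N y = \<gamma> (map (\<lambda>L. blinfun_apply L y) (Ls a))"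
        using good[of a] unfolding good_def by auto
      show "blinfun_apply (N' z) v = 0"
      proof (rule has_derivative_zero_of_local_const[OF der[OF \<open>z \<noteq> 0\<close>]])
        show "open (V a)" "z \<in> V a" using a V[OF a0] by auto
        show "N (z + t *\<^sub>R v) = N z" if "z + t *\<^sub>R v \<in> V a" for t
          using \<gamma>[OF that] \<gamma>[OF a(2)] eq[of t] by simp
      qed
    qed (use a in auto)
  qed
qed

text \<open>The function \<open>b\<close> is one minus a bump: 0 on the unit ball and 1 outside the
  ball of radius \<open>t\<close>. The radii differ because the balls belong to the given norm,
  while \<open>b\<close> is built from an equivalent one.\<close>

locale C1_bump =
  fixes b :: "'a::real_normed_vector \<Rightarrow> real" and Db :: "'a \<Rightarrow> 'a \<Rightarrow>\<^sub>L real"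
    and W :: "('a \<Rightarrow>\<^sub>L real) set" and t B :: real
  assumes countable_W: "countable W"
    and bump_derivative: "(b has_derivative blinfun_apply (Db z)) (at z)"
    and continuous_Db: "continuous_on UNIV Db"
    and bump_range: "0 \<le> b z" "b z \<le> 1"
    and bump_small: "norm z \<le> 1 \<Longrightarrow> b z = 0" "norm z \<le> 1 \<Longrightarrow> Db z = 0"
    and bump_large: "t \<le> norm z \<Longrightarrow> b z = 1" "t \<le> norm z \<Longrightarrow> Db z = 0"
    and t_pos: "0 < t" and B_pos: "0 < B"
    and norm_Db_le: "norm (Db z) \<le> B"
    and vanishes_Db: "vanishes_on_kernel W (Db z)"

text \<open>Compose the step with \<open>N / C\<close>. Since \<open>N / C\<close> is at most 1 on
  the unit ball, the step is 0 there and the singularity of \<open>N\<close> at the origin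
  disappears. Outside radius \<open>2 * C / c\<close> the quotient is at least 2. The Lipschitz
  constant \<open>C\<close> of \<open>N\<close> cancels in the bound for the derivative.\<close>

lemma exists_C1_bump:
  fixes N :: "'a::real_normed_vector \<Rightarrow> real"
  assumes D: "countable (D :: 'a set)" "closure D = UNIV"
    and N: "equivalent_norm N" and C1: "C1_away_from_origin N"
    and lfc: "locally_depends_on_finitely_many_coords N"
  shows "\<exists>(b :: 'a \<Rightarrow> real) Db W t B. C1_bump b Db W t B"
proof -
  obtain N' where der: "\<And>z. z \<noteq> 0 \<Longrightarrow> (N has_derivative blinfun_apply (N' z)) (at z)"
    and cont: "continuous_on (- {0}) N'"
    using C1 unfolding C1_away_from_origin_def by blast
  obtain W where W: "countable W" "\<And>z. z \<noteq> 0 \<Longrightarrow> vanishes_on_kernel W (N' z)"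
    using countable_functionals_of_locally_finite[OF D lfc der] by blast
  obtain c C where c: "0 < c" "0 < C" "\<And>x. c * norm x \<le> N x" "\<And>x. N x \<le> C * norm x"
    using N unfolding equivalent_norm_def by blast
  have tri: "N (x + y) \<le> N x + N y" and hom: "N (r *\<^sub>R x) = \<bar>r\<bar> * N x" for x y r
    using N unfolding equivalent_norm_def is_norm_fun_def by auto
  have sym: "N (- x) = N x" for x
    using hom[of "-1" x] by simp
  have lip: "\<bar>N y - N x\<bar> \<le> C * norm (y - x)" for x y
    using tri[of "y - x" x] tri[of "x - y" y] sym[of "y - x"] c(4)[of "y - x"] by simp
  have boundN': "norm (N' z) \<le> C" if "z \<noteq> 0" for z
    using has_derivative_Lipschitz_bound[OF der[OF that] lip] c by (intro norm_blinfun_bound) auto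
  obtain \<psi> \<psi>' :: "real \<Rightarrow> real" and M where \<psi>:
    "\<And>t. (\<psi> has_real_derivative \<psi>' t) (at t)" "continuous_on UNIV \<psi>'"
    "\<And>t. t \<le> 1 \<Longrightarrow> \<psi> t = 0 \<and> \<psi>' t = 0" "\<And>t. t \<ge> 2 \<Longrightarrow> \<psi> t = 1 \<and> \<psi>' t = 0"
    "\<And>t. 0 \<le> \<psi> t \<and> \<psi> t \<le> 1" "0 < M" "\<And>t. \<bar>\<psi>' t\<bar> \<le> M"
    using exists_C1_step by metis
  define b where "b z = \<psi> (N z / C)" for z
  define Db where "Db z = (if z = 0 then 0 else (\<psi>' (N z / C) / C) *\<^sub>R N' z)" for z
  have small: "b z = 0 \<and> Db z = 0" if "norm z \<le> 1" for z
  proof -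
    have "N z \<le> C * 1"
      using c(2) that by (intro order_trans[OF c(4)] mult_left_mono) auto
    then have "N z / C \<le> 1"
      using c(2) by simp
    then show ?thesis
      using \<psi>(3) by (simp add: b_def Db_def)
  qed
  have large: "b z = 1 \<and> Db z = 0" if "2 * C / c \<le> norm z" for z
  proof -
    have "2 * C \<le> c * norm z"
      using that c(1) by (simp add: pos_divide_le_eq mult.commute)
    then have "2 \<le> N z / C"
      using c(2) c(3)[of z] by (simp add: pos_le_divide_eq)
    then show ?thesis
      using \<psi>(4) by (simp add: b_def Db_def)
  qed
  have derb: "(b has_derivative blinfun_apply (Db z)) (at z)" for z
  proof (cases "z = 0")
    case True
    have "((\<lambda>_. 0) has_derivative blinfun_apply (Db z)) (at z)"
      using True by (simp add: Db_def zero_blinfun.rep_eq)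
    then show ?thesis
      by (rule has_derivative_transform_within_open[OF _ open_ball[of 0 1]]) (use True small in auto)
  next
    case False
    have "((\<lambda>z. N z / C) has_derivative (\<lambda>v. blinfun_apply (N' z) v / C)) (at z)"
      by (rule bounded_linear.has_derivative[OF bounded_linear_divide der[OF False]])
    from DERIV_compose_FDERIV[OF \<psi>(1) this] show ?thesis
      unfolding b_def[abs_def] by (rule has_derivative_eq_rhs)
        (use False in \<open>auto simp: Db_def scaleR_blinfun.rep_eq\<close>)
  qed
  have contDb: "continuous_on UNIV Db"
  proof -
    have "continuous_on (ball 0 1) Db"
      using small by (subst continuous_on_cong[OF refl, of _ _ "\<lambda>_. 0"]) auto
    moreover have "continuous_on (- {0}) Db"
    proof -
      have "continuous_on (- {0}) N"
        by (intro continuous_at_imp_continuous_on ballI has_derivative_continuous[OF der]) auto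
      then have "continuous_on (- {0}) (\<lambda>z. (\<psi>' (N z / C) / C) *\<^sub>R N' z)"
        using c(2) by (intro continuous_intros cont continuous_on_compose2[OF \<psi>(2)]) auto
      then show ?thesis
        by (rule continuous_on_eq) (simp add: Db_def)
    qed
    ultimately have "continuous_on (ball 0 1 \<union> - {0}) Db"
      by (intro continuous_on_open_Un) auto
    moreover have "ball 0 1 \<union> - {0} = (UNIV :: 'a set)"
      by auto
    ultimately show ?thesis by simp
  qed
  have "C1_bump b Db W (2 * C / c) M"
  proof
    show "norm (Db z) \<le> M" for z
    proof (cases "z = 0")
      case False
      have "norm (Db z) = \<bar>\<psi>' (N z / C)\<bar> / C * norm (N' z)"
        using False c by (simp add: Db_def)
      also have "\<dots> \<le> M / C * C"
        using c \<psi>(6) by (intro mult_mono divide_right_mono \<psi>(7) boundN'[OF False]) auto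
      finally show ?thesis using c by simp
    qed (use \<psi>(6) in \<open>simp add: Db_def\<close>)
    show "vanishes_on_kernel W (Db z)" for z
      using W(2)[of z] vanishes_on_kernel_trans[of W "N' z" "Db z"]
      by (cases "z = 0") (auto simp: Db_def vanishes_on_kernel_zero scaleR_blinfun.rep_eq)
  qed (use W derb contDb small large \<psi> c in \<open>auto simp: b_def\<close>)
  then show ?thesis by blast
qed

section \<open>Functionals in general position with respect to a countable set\<close>

text \<open>Each further functional costs at most one spanning vector \<open>u\<close>, so the
  common kernel together with a finite set spans the space. A trivial kernel would make the space
  finite-dimensional.\<close>

lemma kernel_nontrivial:
  fixes S :: "('a::real_normed_vector \<Rightarrow>\<^sub>L real) set"
  assumes "infinite_dimensional TYPE('a)" and "finite S"
  shows "\<exists>z. z \<noteq> 0 \<and> (\<forall>L\<in>S. blinfun_apply L z = 0)"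
proof -
  have "\<exists>B. finite B \<and> span (B \<union> {v. \<forall>L\<in>S. blinfun_apply L v = 0}) = UNIV"
    using \<open>finite S\<close>
  proof (induction S rule: finite_induct)
    case empty
    show ?case by (intro exI[of _ "{}"]) simp
  next
    case (insert L S)
    let ?Z = "{v. \<forall>L\<in>S. blinfun_apply L v = 0}"
    let ?Z' = "{v. \<forall>L\<in>insert L S. blinfun_apply L v = 0}"
    obtain B where B: "finite B" "span (B \<union> ?Z) = UNIV"
      using insert.IH by blast
    show ?case
    proof (cases "?Z \<subseteq> ?Z'")
      case True
      then have "?Z = ?Z'" by auto
      show ?thesis
        unfolding \<open>?Z = ?Z'\<close>[symmetric] using B by (intro exI[of _ B] conjI)
    next
      case False
      then obtain u where u: "u \<in> ?Z" "blinfun_apply L u \<noteq> 0" by auto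
      have "?Z \<subseteq> span (insert u B \<union> ?Z')"
      proof
        fix v assume v: "v \<in> ?Z"
        define c where "c = blinfun_apply L v / blinfun_apply L u"
        have "v - c *\<^sub>R u \<in> ?Z'"
          using u v by (auto simp: blinfun.diff_right blinfun.scaleR_right c_def)
        then have "(v - c *\<^sub>R u) + c *\<^sub>R u \<in> span (insert u B \<union> ?Z')"
          by (intro span_add span_scale) (auto intro: span_base)
        then show "v \<in> span (insert u B \<union> ?Z')" by simp
      qed
      moreover have "B \<subseteq> span (insert u B \<union> ?Z')"
        by (auto intro: span_base)
      ultimately have "span (B \<union> ?Z) \<subseteq> span (insert u B \<union> ?Z')"
        by (intro span_minimal) auto
      then show ?thesis
        using B by (intro exI[of _ "insert u B"]) auto
    qed
  qed
  then obtain B where B: "finite B" "span (B \<union> {v. \<forall>L\<in>S. blinfun_apply L v = 0}) = UNIV"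
    by blast
  have "span B \<noteq> UNIV"
    using assms(1) B(1) by (simp add: infinite_dimensional_def)
  have "{v. \<forall>L\<in>S. blinfun_apply L v = 0} \<noteq> {0}"
  proof
    assume "{v. \<forall>L\<in>S. blinfun_apply L v = 0} = {0}"
    with B(2) have "span (insert 0 B) = UNIV" by simp
    with \<open>span B \<noteq> UNIV\<close> show False by simp
  qed
  moreover have "0 \<in> {v. \<forall>L\<in>S. blinfun_apply L v = 0}"
    by simp
  ultimately show ?thesis by blast
qed

context unconditional_schauder_basis
begin

lemma coordL_apply [simp]: "blinfun_apply (coordL n) x = coord x n"
  by (simp add: coordL.rep_eq)

lemma tailL_apply [simp]: "blinfun_apply (tailL n) x = tail n x"
  by (simp add: tailL.rep_eq)

text \<open>For each of the countably many finite \<open>S\<close>, the functionals that are not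
  zero on the common kernel form an open dense set \<open>G n\<close> in the dual, and Baire gives a
  common element. For density, take a nonzero \<open>z\<close> in the kernel and add a small
  multiple of a coordinate functional that does not vanish at \<open>z\<close>.\<close>

lemma exists_functional_nonzero_on_kernels:
  assumes inf: "infinite_dimensional TYPE('a)" and W: "countable (W :: ('a \<Rightarrow>\<^sub>L real) set)"
  shows "\<exists>T :: 'a \<Rightarrow>\<^sub>L real. \<forall>S. finite S \<longrightarrow> S \<subseteq> W \<longrightarrow>
    (\<exists>z. (\<forall>L\<in>S. blinfun_apply L z = 0) \<and> blinfun_apply T z \<noteq> 0)"
proof -
  define F where "F = {S. finite S \<and> S \<subseteq> W}"
  have F: "countable F" "F \<noteq> {}"
    using countable_Collect_finite_subset[OF W] by (auto simp: F_def)
  define G :: "nat \<Rightarrow> ('a \<Rightarrow>\<^sub>L real) set" where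
    "G n = (\<Union>z\<in>{z. \<forall>L\<in>from_nat_into F n. blinfun_apply L z = 0}. {T. blinfun_apply T z \<noteq> 0})" for n
  have "open (G n)" for n
    unfolding G_def by (intro open_UN ballI open_Collect_neq continuous_intros)
  moreover have "closure (G n) = UNIV" for n
  proof -
    have "T \<in> closure (G n)" for T
    proof (cases "T \<in> G n")
      case True
      then show ?thesis using closure_subset by blast
    next
      case False
      have "finite (from_nat_into F n)"
        using from_nat_into[OF F(2), of n] by (simp add: F_def)
      then obtain z where z: "z \<noteq> 0" "\<forall>L\<in>from_nat_into F n. blinfun_apply L z = 0"
        using kernel_nontrivial[OF inf] by blast
      obtain k where k: "coord z k \<noteq> 0"
        using coord_nonzero[OF z(1)] by blast
      have "blinfun_apply T z = 0"
        using False z(2) by (auto simp: G_def)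
      show ?thesis
        unfolding closure_approachable
      proof (intro allI impI)
        fix \<delta> :: real assume "0 < \<delta>"
        define s where "s = \<delta> / (1 + norm (coordL k))"
        have pos: "0 < 1 + norm (coordL k)"
          by (simp add: add_pos_nonneg)
        have s: "0 < s" "s * norm (coordL k) < \<delta>"
          using \<open>0 < \<delta>\<close> pos by (auto simp: s_def field_simps)
        have "T + s *\<^sub>R coordL k \<in> G n"
          using z(2) s k \<open>blinfun_apply T z = 0\<close>
          by (auto simp: G_def blinfun.add_left blinfun.scaleR_left intro!: exI[of _ z])
        then show "\<exists>y\<in>G n. dist y T < \<delta>"
          using s by (intro bexI[of _ "T + s *\<^sub>R coordL k"]) (auto simp: dist_norm)
      qed
    qed
    then show ?thesis by blast
  qed
  ultimately obtain T where T: "\<And>n. T \<in> G n"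
    using Baire_inter_nonempty by metis
  have "\<exists>z. (\<forall>L\<in>S. blinfun_apply L z = 0) \<and> blinfun_apply T z \<noteq> 0" if "finite S" "S \<subseteq> W" for S
  proof -
    have "S \<in> F" using that by (simp add: F_def)
    then obtain n where "from_nat_into F n = S"
      using from_nat_into_surj[OF F(1)] by blast
    then show ?thesis
      using T[of n] by (auto simp: G_def)
  qed
  then show ?thesis by blast
qed

text \<open>Each functional is chosen generic with respect to \<open>W\<close> and all of its
  predecessors. This triangular condition is what makes the whole tuple onto.\<close>

lemma exists_functionals_nonzero_on_kernels:
  assumes inf: "infinite_dimensional TYPE('a)" and W: "countable W"
  shows "\<exists>T :: nat \<Rightarrow> 'a \<Rightarrow>\<^sub>L real. \<forall>i<m. \<forall>S. finite S \<longrightarrow> S \<subseteq> W \<union> T ` {..<i} \<longrightarrow>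
    (\<exists>z. (\<forall>L\<in>S. blinfun_apply L z = 0) \<and> blinfun_apply (T i) z \<noteq> 0)"
proof (induction m)
  case (Suc m)
  from Suc.IH obtain T :: "nat \<Rightarrow> 'a \<Rightarrow>\<^sub>L real"
    where T: "\<forall>i<m. \<forall>S. finite S \<longrightarrow> S \<subseteq> W \<union> T ` {..<i} \<longrightarrow>
      (\<exists>z. (\<forall>L\<in>S. blinfun_apply L z = 0) \<and> blinfun_apply (T i) z \<noteq> 0)"
    by (rule exE)
  have "countable (W \<union> T ` {..<m})"
    using W by simp
  from exists_functional_nonzero_on_kernels[OF inf this] obtain R :: "'a \<Rightarrow>\<^sub>L real"
    where R: "\<forall>S. finite S \<longrightarrow> S \<subseteq> W \<union> T ` {..<m} \<longrightarrow>
      (\<exists>z. (\<forall>L\<in>S. blinfun_apply L z = 0) \<and> blinfun_apply R z \<noteq> 0)"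
    by (rule exE)
  have img: "(T(m := R)) ` {..<i} = T ` {..<i}" if "i \<le> m" for i
    using that by (intro image_cong) auto
  show ?case
  proof (intro exI[of _ "T(m := R)"] allI impI)
    fix i S assume i: "i < Suc m" and S: "finite S" "S \<subseteq> W \<union> (T(m := R)) ` {..<i}"
    have S': "S \<subseteq> W \<union> T ` {..<i}"
      using S(2) img[of i] i by simp
    show "\<exists>z. (\<forall>L\<in>S. blinfun_apply L z = 0) \<and> blinfun_apply ((T(m := R)) i) z \<noteq> 0"
    proof (cases "i = m")
      case True
      then show ?thesis
        using R[rule_format, OF S(1)] S' by simp
    next
      case False
      then show ?thesis
        using T[rule_format, OF _ S(1) S'] i by simp
    qed
  qed
qed auto

lemma exists_surjective_on_kernels:
  assumes inf: "infinite_dimensional TYPE('a)" and W: "countable (W :: ('a \<Rightarrow>\<^sub>L real) set)"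
  shows "\<exists>T :: 'a \<Rightarrow>\<^sub>L (real ^ 'd). \<forall>S. finite S \<longrightarrow> S \<subseteq> W \<longrightarrow>
    (\<forall>y. \<exists>v. (\<forall>L\<in>S. blinfun_apply L v = 0) \<and> blinfun_apply T v = y)"
proof -
  obtain h :: "'d \<Rightarrow> nat" where h: "bij_betw h UNIV {..<CARD('d)}"
    using ex_bij_betw_finite_nat[of "UNIV :: 'd set"] by (auto simp: lessThan_atLeast0)
  from exists_functionals_nonzero_on_kernels[OF inf W, of "CARD('d)"]
  obtain T :: "nat \<Rightarrow> 'a \<Rightarrow>\<^sub>L real"
    where T: "\<forall>i<CARD('d). \<forall>S. finite S \<longrightarrow> S \<subseteq> W \<union> T ` {..<i} \<longrightarrow>
      (\<exists>z. (\<forall>L\<in>S. blinfun_apply L z = 0) \<and> blinfun_apply (T i) z \<noteq> 0)"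
    by (rule exE)
  have bl: "bounded_linear (\<lambda>x. \<chi> i. blinfun_apply (T (h i)) x)"
    by (subst bounded_linear_componentwise_iff)
       (auto simp: Basis_vec_def inner_axis intro: blinfun.bounded_linear_right)
  define TT :: "'a \<Rightarrow>\<^sub>L (real ^ 'd)" where "TT = Blinfun (\<lambda>x. \<chi> i. blinfun_apply (T (h i)) x)"
  have TT: "blinfun_apply TT x = (\<chi> i. blinfun_apply (T (h i)) x)" for x
    unfolding TT_def by (simp add: bounded_linear_Blinfun_apply[OF bl])
  have "\<exists>v. (\<forall>L\<in>S. blinfun_apply L v = 0) \<and> blinfun_apply TT v = y" if S: "finite S" "S \<subseteq> W" for S y
  proof (rule ccontr)
    assume no: "\<not> ?thesis"
    define Z where "Z = {v. \<forall>L\<in>S. blinfun_apply L v = 0}"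
    have "subspace Z"
      by (auto simp: Z_def subspace_def blinfun.add_right blinfun.scaleR_right)
    then have sub: "subspace (blinfun_apply TT ` Z)"
      by (intro linear_subspace_image bounded_linear.linear blinfun.bounded_linear_right)
    have "y \<notin> blinfun_apply TT ` Z"
      using no by (auto simp: Z_def)
    then have "span (blinfun_apply TT ` Z) \<noteq> UNIV"
      using sub by (metis UNIV_I span_eq_iff)
    then obtain c where c: "c \<noteq> 0" "\<And>w. w \<in> span (blinfun_apply TT ` Z) \<Longrightarrow> orthogonal c w"
      using orthogonal_to_subspace_exists_gen[of "blinfun_apply TT ` Z" UNIV] by auto
    define J where "J = {i. c $ i \<noteq> 0}"
    have "J \<noteq> {}" using c(1) by (auto simp: J_def vec_eq_iff)
    \<comment> \<open>Take the last component at which the normal vector \<open>c\<close> of the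
      image is nonzero. A vector \<open>z\<close> killed by \<open>S\<close> and by all earlier
      functionals, but not by this one, then has
      \<open>c \<bullet> blinfun_apply TT z \<noteq> 0\<close>: later components have coefficient 0,
      earlier ones vanish at \<open>z\<close>.\<close>
    then obtain i where i: "i \<in> J" "\<And>j. j \<in> J \<Longrightarrow> h j \<le> h i"
      using obtains_MAX[of J h] by (metis Max_ge finite finite_imageI imageI)
    have hi: "h i < CARD('d)"
      using h by (auto simp: bij_betw_def)
    have S': "finite (S \<union> T ` {..<h i})" "S \<union> T ` {..<h i} \<subseteq> W \<union> T ` {..<h i}"
      using S by auto
    obtain z where z: "\<forall>L\<in>S \<union> T ` {..<h i}. blinfun_apply L z = 0" "blinfun_apply (T (h i)) z \<noteq> 0"
      using T[rule_format, OF hi S'] by (elim exE conjE)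
    have "c \<bullet> blinfun_apply TT z = 0"
      using c(2)[of "blinfun_apply TT z"] z by (auto simp: orthogonal_def Z_def intro!: span_base)
    moreover have "c \<bullet> blinfun_apply TT z = c $ i * blinfun_apply (T (h i)) z"
    proof -
      have "c $ j * blinfun_apply (T (h j)) z = 0" if "j \<noteq> i" for j
      proof (cases "j \<in> J")
        case True
        then have "h j < h i"
          using i(2)[OF True] h that by (metis bij_betw_def UNIV_I inj_onD le_neq_implies_less)
        then show ?thesis using z(1) by auto
      qed (simp add: J_def)
      then show ?thesis
        unfolding inner_vec_def TT by (subst sum.remove[of _ i]) (auto intro!: sum.neutral, blast)
    qed
    ultimately show False
      using i(1) z(2) by (simp add: J_def)
  qed
  then show ?thesis by blast
qed

end

section \<open>Smooth maps close to the identity with locally finite-dimensional range\<close>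

lemma continuous_on_blinfun_compose [continuous_intros]:
  "continuous_on S f \<Longrightarrow> continuous_on S g \<Longrightarrow> continuous_on S (\<lambda>x. f x o\<^sub>L g x)"
  by (rule bounded_bilinear.continuous_on[OF bounded_bilinear_blinfun_compose])

locale unconditional_C1_bump = unconditional_schauder_basis e + C1_bump b Db W t B
  for e :: "nat \<Rightarrow> 'a::banach" and b :: "'a \<Rightarrow> real" and Db :: "'a \<Rightarrow> 'a \<Rightarrow>\<^sub>L real"
    and W :: "('a \<Rightarrow>\<^sub>L real) set" and t B :: real
begin

text \<open>The term of index \<open>n\<close> of the expansion, smoothly switched off once the tail
  starting at \<open>n\<close> lies in the unit ball. As tails tend to 0, only finitely many terms
  survive, and where the tail is large nothing is changed.\<close>

definition piece :: "nat \<Rightarrow> 'a \<Rightarrow> 'a" where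
  "piece n x = (b (tail n x) * coord x n) *\<^sub>R e n"

definition Dpiece :: "nat \<Rightarrow> 'a \<Rightarrow> 'a \<Rightarrow>\<^sub>L 'a" where
  "Dpiece n x = blinfun_scaleR_left (e n) o\<^sub>L
     (b (tail n x) *\<^sub>R coordL n + coord x n *\<^sub>R (Db (tail n x) o\<^sub>L tailL n))"

lemma Dpiece_apply: "blinfun_apply (Dpiece n x) v =
    (b (tail n x) * coord v n + coord x n * blinfun_apply (Db (tail n x)) (tail n v)) *\<^sub>R e n"
  by (simp add: Dpiece_def blinfun.add_left blinfun.scaleR_left)

lemma has_derivative_piece: "(piece n has_derivative blinfun_apply (Dpiece n x)) (at x)"
proof -
  have 1: "((\<lambda>x. b (tail n x)) has_derivative (\<lambda>v. blinfun_apply (Db (tail n x)) (tail n v))) (at x)"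
    by (rule has_derivative_compose[OF bounded_linear_imp_has_derivative[OF bounded_linear_tail] bump_derivative])
  have 2: "((\<lambda>x. coord x n) has_derivative (\<lambda>v. coord v n)) (at x)"
    by (rule bounded_linear_imp_has_derivative[OF bounded_linear_coord])
  have "((\<lambda>x. (b (tail n x) * coord x n) *\<^sub>R e n) has_derivative
      (\<lambda>v. (b (tail n x) * coord v n + blinfun_apply (Db (tail n x)) (tail n v) * coord x n) *\<^sub>R e n)) (at x)"
    by (rule has_derivative_scaleR_left[OF has_derivative_mult[OF 1 2]])
  then show ?thesis
    unfolding piece_def [abs_def] by (rule has_derivative_eq_rhs) (simp add: fun_eq_iff Dpiece_apply mult.commute)
qed

lemma continuous_on_tail: "continuous_on S (tail n)"
  by (rule linear_continuous_on[OF bounded_linear_tail])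

lemma continuous_on_Dpiece: "continuous_on UNIV (Dpiece n)"
proof -
  have "continuous_on UNIV b"
    by (intro continuous_at_imp_continuous_on ballI has_derivative_continuous[OF bump_derivative])
  then have "continuous_on UNIV (\<lambda>x. b (tail n x))"
    by (rule continuous_on_compose2[OF _ continuous_on_tail]) simp
  moreover have "continuous_on UNIV (\<lambda>x. Db (tail n x))"
    by (rule continuous_on_compose2[OF continuous_Db continuous_on_tail]) simp
  moreover have "continuous_on UNIV (\<lambda>x. coord x n)"
    by (rule linear_continuous_on[OF bounded_linear_coord])
  ultimately show ?thesis
    unfolding Dpiece_def [abs_def] by (intro continuous_intros)
qed

text \<open>All tail operators have norm at most \<open>1 + K\<close>. So if the tails of
  \<open>x\<close> are below 1/2 from \<open>m\<close> on, then the tails of all \<open>y\<close> in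
  a small ball stay in the unit ball, with the same \<open>m\<close>. The trivial inclusion in
  \<open>UNIV\<close> matches the form of \<open>C1_locally_finite_sum\<close>.\<close>

lemma pieces_locally_finite:
  "\<exists>m V. open V \<and> x \<in> V \<and> V \<subseteq> UNIV \<and> (\<forall>y\<in>V. \<forall>n\<ge>m. piece n y = 0 \<and> Dpiece n y = 0)"
proof -
  obtain m where m: "\<And>n. n \<ge> m \<Longrightarrow> norm (tail n x) < 1/2"
    using tendstoD[OF tail_tendsto_0, of "1/2" x] by (auto simp: eventually_sequentially)
  define s where "s = 1 / (2 * (1 + K))"
  have s: "0 < s" "(1 + K) * s = 1/2" using K_pos by (auto simp: s_def)
  have "piece n y = 0 \<and> Dpiece n y = 0" if "y \<in> ball x s" "n \<ge> m" for y n
  proof -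
    have "tail n y = tail n x + tail n (y - x)"
      using linear_diff[OF bounded_linear.linear[OF bounded_linear_tail], of n y x] by simp
    then have "norm (tail n y) \<le> norm (tail n x) + (1 + K) * norm (y - x)"
      using norm_triangle_ineq[of "tail n x" "tail n (y - x)"] norm_tail_le[of n "y - x"] by simp
    also have "\<dots> \<le> 1/2 + (1 + K) * s"
      using m[OF that(2)] that(1) K_pos
      by (intro add_mono mult_left_mono) (auto simp: dist_norm norm_minus_commute)
    finally have "norm (tail n y) \<le> 1" using s by simp
    then show ?thesis
      using bump_small by (simp add: piece_def Dpiece_def)
  qed
  then show ?thesis
    using s by (intro exI[of _ m] exI[of _ "ball x s"]) auto
qed

text \<open>If the multipliers \<open>\<theta> n\<close> vanish wherever the tail is large, then only the coordinates of one
  single small tail matter.\<close>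

lemma replace_by_small_tail:
  assumes "\<And>n. \<theta> n \<noteq> (0::real) \<Longrightarrow> norm (tail n x) \<le> t"
  shows "\<exists>z. norm z \<le> t \<and> (\<forall>n. \<theta> n * coord x n = \<theta> n * coord z n)"
proof (cases "\<exists>n. \<theta> n \<noteq> 0")
  case True
  \<comment> \<open>The tail at the first active index is small by assumption and retains every
    coordinate with a nonzero multiplier.\<close>
  define m where "m = (LEAST n. \<theta> n \<noteq> 0)"
  have m: "\<theta> m \<noteq> 0"
    unfolding m_def by (rule LeastI_ex[OF True])
  have m0: "\<theta> n = 0" if "n < m" for n
    using not_less_Least[OF that[unfolded m_def]] by simp
  have "\<theta> n * coord x n = \<theta> n * coord (tail m x) n" for n
    using m0[of n] by (cases "m \<le> n") (simp_all add: coord_tail)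
  then show ?thesis
    using assms[OF m] by (intro exI[of _ "tail m x"]) simp
next
  case False
  then show ?thesis
    using t_pos by (intro exI[of _ 0]) simp
qed

text \<open>The difference is the multiplier \<open>1 - b (tail n x)\<close>, which is 0 where the
  tail has norm at least \<open>t\<close>. Hence \<open>x\<close> can be replaced by a vector of
  norm at most \<open>t\<close>, and the bound does not depend on \<open>x\<close>.\<close>

lemma norm_piece_sum_diff_le:
  "norm ((\<Sum>n<p. piece n x) - (\<Sum>n<p. coord x n *\<^sub>R e n)) \<le> K * t"
proof -
  define \<theta> where "\<theta> n = 1 - b (tail n x)" for n
  have "norm (tail n x) \<le> t" if "\<theta> n \<noteq> 0" for n
    using that bump_large(1)[of "tail n x"] by (force simp: \<theta>_def)
  then obtain z where z: "norm z \<le> t" "\<And>n. \<theta> n * coord x n = \<theta> n * coord z n"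
    using replace_by_small_tail by metis
  have "(\<Sum>n<p. piece n x) - (\<Sum>n<p. coord x n *\<^sub>R e n) = - (\<Sum>n<p. (\<theta> n * coord x n) *\<^sub>R e n)"
    by (simp add: piece_def \<theta>_def left_diff_distrib scaleR_diff_left sum_subtractf)
  also have "norm \<dots> = norm (\<Sum>n<p. (\<theta> n * coord z n) *\<^sub>R e n)"
    by (simp add: z(2))
  also have "\<dots> \<le> K * norm z"
    using bump_range by (intro norm_multiplier_le) (auto simp: \<theta>_def)
  also have "\<dots> \<le> K * t"
    using z(1) K_pos by simp
  finally show ?thesis .
qed

text \<open>The product rule gives two multipliers. The one with \<open>b\<close> acts on
  \<open>v\<close> and lies in [0,1]. The one with \<open>Db\<close> acts on \<open>x\<close>, which
  may be large; but \<open>Db\<close> vanishes at large tails, so again \<open>x\<close> is replaced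
  by a vector of norm at most \<open>t\<close>.\<close>

lemma norm_Dpiece_sum_le:
  "norm (\<Sum>n<m. Dpiece n x) \<le> K + 2 * (B * (1 + K)) * K * t"
proof (rule norm_blinfun_bound)
  show "0 \<le> K + 2 * (B * (1 + K)) * K * t"
    using K_pos B_pos t_pos by simp
  fix v
  define \<theta> where "\<theta> n = blinfun_apply (Db (tail n x)) (tail n v)" for n
  have "norm (tail n x) \<le> t" if "\<theta> n \<noteq> 0" for n
    using that bump_large(2)[of "tail n x"] by (force simp: \<theta>_def)
  then obtain z where z: "norm z \<le> t" "\<And>n. \<theta> n * coord x n = \<theta> n * coord z n"
    using replace_by_small_tail by metis
  have \<theta>_le: "\<bar>\<theta> n\<bar> \<le> B * ((1 + K) * norm v)" for n
  proof -
    have "\<bar>\<theta> n\<bar> \<le> norm (Db (tail n x)) * norm (tail n v)"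
      unfolding \<theta>_def using norm_blinfun[of "Db (tail n x)" "tail n v"] by simp
    also have "\<dots> \<le> B * ((1 + K) * norm v)"
      using B_pos by (intro mult_mono norm_Db_le norm_tail_le) auto
    finally show ?thesis .
  qed
  have "blinfun_apply (\<Sum>n<m. Dpiece n x) v = (\<Sum>n<m. (b (tail n x) * coord v n) *\<^sub>R e n)
      + (\<Sum>n<m. (\<theta> n * coord x n) *\<^sub>R e n)"
    by (simp add: blinfun.sum_left Dpiece_apply \<theta>_def scaleR_add_left sum.distrib mult.commute)
  also have "(\<Sum>n<m. (\<theta> n * coord x n) *\<^sub>R e n) = (\<Sum>n<m. (\<theta> n * coord z n) *\<^sub>R e n)"
    by (simp add: z(2))
  also have "norm ((\<Sum>n<m. (b (tail n x) * coord v n) *\<^sub>R e n) + (\<Sum>n<m. (\<theta> n * coord z n) *\<^sub>R e n))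
      \<le> K * norm v + 2 * (B * ((1 + K) * norm v)) * K * norm z"
    using \<theta>_le bump_range K_pos B_pos
    by (intro norm_triangle_mono norm_multiplier_le norm_signed_multiplier_le) auto
  also have "\<dots> \<le> K * norm v + 2 * (B * ((1 + K) * norm v)) * K * t"
    using z(1) K_pos B_pos by (intro add_left_mono mult_left_mono) auto
  finally show "norm (blinfun_apply (\<Sum>n<m. Dpiece n x) v) \<le> (K + 2 * (B * (1 + K)) * K * t) * norm v"
    by (simp add: algebra_simps)
qed

definition kernel_functionals :: "('a \<Rightarrow>\<^sub>L real) set" where
  "kernel_functionals = range coordL \<union> (\<Union>n. (\<lambda>L. L o\<^sub>L tailL n) ` W)"

lemma countable_kernel_functionals: "countable kernel_functionals"
  unfolding kernel_functionals_def using countable_W by auto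

lemma vanishes_Dpiece: "vanishes_on_kernel kernel_functionals (Dpiece n x)"
proof -
  have "vanishes_on_kernel kernel_functionals (coordL n)"
    by (rule vanishes_on_kernel_member) (simp add: kernel_functionals_def)
  moreover have "vanishes_on_kernel kernel_functionals (Db (tail n x) o\<^sub>L tailL n)"
    using vanishes_on_kernel_compose_right[OF vanishes_Db]
    by (rule vanishes_on_kernel_mono) (auto simp: kernel_functionals_def)
  ultimately have "vanishes_on_kernel kernel_functionals
      (b (tail n x) *\<^sub>R coordL n + coord x n *\<^sub>R (Db (tail n x) o\<^sub>L tailL n))"
    by (intro vanishes_on_kernel_add vanishes_on_kernel_scaleR)
  then show ?thesis
    unfolding Dpiece_def by (rule vanishes_on_kernel_compose_left)
qed

lemma exists_near_identity:
  "\<exists>(\<Psi> :: 'a \<Rightarrow> 'a) D\<Psi> C. 0 < C \<and> (\<forall>x. (\<Psi> has_derivative blinfun_apply (D\<Psi> x)) (at x)) \<and>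
    continuous_on UNIV D\<Psi> \<and> (\<forall>x. norm (\<Psi> x - x) \<le> C) \<and> (\<forall>x. norm (D\<Psi> x) \<le> C) \<and>
    (\<forall>x. vanishes_on_kernel kernel_functionals (D\<Psi> x))"
proof -
  have "\<exists>g Dg. (\<forall>x\<in>UNIV. (g has_derivative blinfun_apply (Dg x)) (at x)) \<and> continuous_on UNIV Dg \<and>
    (\<forall>x\<in>UNIV. \<forall>m. (\<forall>n\<ge>m. piece n x = 0 \<and> Dpiece n x = 0) \<longrightarrow>
      g x = (\<Sum>n<m. piece n x) \<and> Dg x = (\<Sum>n<m. Dpiece n x))"
    by (rule C1_locally_finite_sum) (rule has_derivative_piece continuous_on_Dpiece pieces_locally_finite)+
  then obtain \<Psi> D\<Psi> where der: "\<And>x. (\<Psi> has_derivative blinfun_apply (D\<Psi> x)) (at x)"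
    and cont: "continuous_on UNIV D\<Psi>"
    and eq: "\<And>x m. \<forall>n\<ge>m. piece n x = 0 \<and> Dpiece n x = 0 \<Longrightarrow>
        \<Psi> x = (\<Sum>n<m. piece n x) \<and> D\<Psi> x = (\<Sum>n<m. Dpiece n x)"
    by auto
  have ex: "\<exists>m. \<forall>p\<ge>m. \<Psi> x = (\<Sum>n<p. piece n x) \<and> D\<Psi> x = (\<Sum>n<p. Dpiece n x)" for x
  proof -
    obtain m where "\<forall>n\<ge>m. piece n x = 0 \<and> Dpiece n x = 0"
      using pieces_locally_finite[of x] by blast
    then show ?thesis
      using eq by (intro exI[of _ m]) (meson order_trans)
  qed
  have near: "norm (\<Psi> x - x) \<le> K * t" for x
  proof -
    obtain m where m: "\<And>p. p \<ge> m \<Longrightarrow> \<Psi> x = (\<Sum>n<p. piece n x)"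
      using ex by blast
    show ?thesis
    \<comment> \<open>\<open>\<Psi> x\<close> equals its partial sums from some index on, whereas
      the partial sums of the expansion only converge to \<open>x\<close>; so the estimate for
      partial sums passes to the limit.\<close>
    proof (rule tendsto_upperbound)
      show "(\<lambda>p. norm (\<Psi> x - (\<Sum>n<p. coord x n *\<^sub>R e n))) \<longlonglongrightarrow> norm (\<Psi> x - x)"
        using sums_coord[of x] by (intro tendsto_intros) (simp add: sums_def)
      show "\<forall>\<^sub>F p in sequentially. norm (\<Psi> x - (\<Sum>n<p. coord x n *\<^sub>R e n)) \<le> K * t"
        unfolding eventually_sequentially using m norm_piece_sum_diff_le by metis
    qed simp
  qed
  define C where "C = K * t + (K + 2 * (B * (1 + K)) * K * t)"
  have pos: "0 < K * t" "0 < K + 2 * (B * (1 + K)) * K * t"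
    using K_pos t_pos B_pos by (auto intro!: add_pos_nonneg)
  have "norm (D\<Psi> x) \<le> K + 2 * (B * (1 + K)) * K * t" for x
    using ex[of x] norm_Dpiece_sum_le[of x] by (metis order_refl)
  moreover have "vanishes_on_kernel kernel_functionals (D\<Psi> x)" for x
  proof -
    obtain m where "D\<Psi> x = (\<Sum>n<m. Dpiece n x)"
      using ex[of x] by blast
    then show ?thesis
      by (simp add: vanishes_on_kernel_sum vanishes_Dpiece)
  qed
  ultimately show ?thesis
    using der cont near pos
    by (intro exI[of _ \<Psi>] exI[of _ D\<Psi>] exI[of _ C] conjI allI)
       (auto simp: C_def add_increasing add_increasing2)
qed

text \<open>Conjugation with a dilation: \<open>r *\<^sub>R \<Psi> ((1/r) *\<^sub>R x)\<close> is
  \<open>r\<close> times closer to the identity, while its derivative is \<open>D\<Psi>\<close> at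
  another point. So the derivative bound and the functionals remain the same.\<close>

lemma exists_nearer_identity:
  "\<exists>C>0. \<forall>s>0. \<exists>(\<Psi> :: 'a \<Rightarrow> 'a) D\<Psi>. (\<forall>x. (\<Psi> has_derivative blinfun_apply (D\<Psi> x)) (at x)) \<and>
    continuous_on UNIV D\<Psi> \<and> (\<forall>x. norm (\<Psi> x - x) \<le> s) \<and> (\<forall>x. norm (D\<Psi> x) \<le> C) \<and>
    (\<forall>x. vanishes_on_kernel kernel_functionals (D\<Psi> x))"
proof -
  obtain \<Psi> :: "'a \<Rightarrow> 'a" and D\<Psi> C where C: "0 < C"
    and der: "\<And>x. (\<Psi> has_derivative blinfun_apply (D\<Psi> x)) (at x)"
    and cont: "continuous_on UNIV D\<Psi>" and near: "\<And>x. norm (\<Psi> x - x) \<le> C"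
    and bound: "\<And>x. norm (D\<Psi> x) \<le> C" and van: "\<And>x. vanishes_on_kernel kernel_functionals (D\<Psi> x)"
    using exists_near_identity by metis
  show ?thesis
  proof (intro exI[of _ C] conjI allI impI C)
    fix s :: real assume "0 < s"
    define r where "r = s / C"
    have r: "0 < r" "r * C = s" using \<open>0 < s\<close> C by (auto simp: r_def)
    have "((\<lambda>x. r *\<^sub>R \<Psi> ((1/r) *\<^sub>R x)) has_derivative blinfun_apply (D\<Psi> ((1/r) *\<^sub>R x))) (at x)" for x
    proof -
      have "((\<lambda>x. r *\<^sub>R \<Psi> ((1/r) *\<^sub>R x)) has_derivative
          (\<lambda>v. r *\<^sub>R blinfun_apply (D\<Psi> ((1/r) *\<^sub>R x)) ((1/r) *\<^sub>R v))) (at x)"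
        by (intro has_derivative_scaleR_right has_derivative_compose[OF _ der] has_derivative_ident)
      then show ?thesis
        by (rule has_derivative_eq_rhs) (use r in \<open>simp add: blinfun.scaleR_right\<close>)
    qed
    moreover have "continuous_on UNIV (\<lambda>x. D\<Psi> ((1/r) *\<^sub>R x))"
      by (rule continuous_on_compose2[OF cont]) (auto intro!: continuous_intros)
    moreover have "norm (r *\<^sub>R \<Psi> ((1/r) *\<^sub>R x) - x) \<le> s" for x
    proof -
      have "r *\<^sub>R \<Psi> ((1/r) *\<^sub>R x) - x = r *\<^sub>R (\<Psi> ((1/r) *\<^sub>R x) - (1/r) *\<^sub>R x)"
        using r by (simp add: scaleR_diff_right)
      then have "norm (r *\<^sub>R \<Psi> ((1/r) *\<^sub>R x) - x) = r * norm (\<Psi> ((1/r) *\<^sub>R x) - (1/r) *\<^sub>R x)"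
        using r by simp
      also have "\<dots> \<le> r * C"
        using r by (intro mult_left_mono near) auto
      finally show ?thesis using r by simp
    qed
    ultimately show "\<exists>(\<Psi> :: 'a \<Rightarrow> 'a) D\<Psi>. (\<forall>x. (\<Psi> has_derivative blinfun_apply (D\<Psi> x)) (at x)) \<and>
      continuous_on UNIV D\<Psi> \<and> (\<forall>x. norm (\<Psi> x - x) \<le> s) \<and> (\<forall>x. norm (D\<Psi> x) \<le> C) \<and>
      (\<forall>x. vanishes_on_kernel kernel_functionals (D\<Psi> x))"
      using bound van
      by (intro exI[of _ "\<lambda>x. r *\<^sub>R \<Psi> ((1/r) *\<^sub>R x)"] exI[of _ "\<lambda>x. D\<Psi> ((1/r) *\<^sub>R x)"] conjI allI)
  qed
qed

end

section \<open>Partitions of unity and gluing\<close>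

context C1_bump
begin

text \<open>\<open>cutoff a \<rho> m\<close> is the product over \<open>i < m\<close> of functions vanishing near \<open>a i\<close>; successive
  differences of these products form the partition of unity.\<close>

primrec cutoff :: "(nat \<Rightarrow> 'a) \<Rightarrow> (nat \<Rightarrow> real) \<Rightarrow> nat \<Rightarrow> 'a \<Rightarrow> real" where
  "cutoff a \<rho> 0 x = 1"
| "cutoff a \<rho> (Suc m) x = cutoff a \<rho> m x * b ((1 / \<rho> m) *\<^sub>R (x - a m))"

primrec Dcutoff :: "(nat \<Rightarrow> 'a) \<Rightarrow> (nat \<Rightarrow> real) \<Rightarrow> nat \<Rightarrow> 'a \<Rightarrow> 'a \<Rightarrow>\<^sub>L real" where
  "Dcutoff a \<rho> 0 x = 0"
| "Dcutoff a \<rho> (Suc m) x = cutoff a \<rho> m x *\<^sub>R ((1 / \<rho> m) *\<^sub>R Db ((1 / \<rho> m) *\<^sub>R (x - a m)))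
     + b ((1 / \<rho> m) *\<^sub>R (x - a m)) *\<^sub>R Dcutoff a \<rho> m x"

lemma has_derivative_scaled_bump:
  "((\<lambda>x. b (r *\<^sub>R (x - c))) has_derivative blinfun_apply (r *\<^sub>R Db (r *\<^sub>R (x - c)))) (at x)"
proof -
  have "((\<lambda>x. r *\<^sub>R (x - c)) has_derivative (\<lambda>v. r *\<^sub>R v)) (at x)"
    by (auto intro!: derivative_eq_intros)
  from has_derivative_compose[OF this bump_derivative] show ?thesis
    by (rule has_derivative_eq_rhs) (simp add: fun_eq_iff blinfun.scaleR_right blinfun.scaleR_left)
qed

lemma has_derivative_cutoff: "(cutoff a \<rho> m has_derivative blinfun_apply (Dcutoff a \<rho> m x)) (at x)"
proof (induction m)
  case 0
  then show ?case by (simp add: cutoff.simps(1)[abs_def] zero_blinfun.rep_eq)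
next
  case (Suc m)
  show ?case
    unfolding cutoff.simps(2)[abs_def]
    by (rule has_derivative_eq_rhs[OF has_derivative_mult[OF Suc has_derivative_scaled_bump]])
       (simp add: fun_eq_iff blinfun.add_left blinfun.scaleR_left mult.commute)
qed

lemma continuous_on_cutoff: "continuous_on UNIV (cutoff a \<rho> m)"
  by (intro continuous_at_imp_continuous_on ballI has_derivative_continuous[OF has_derivative_cutoff])

lemma continuous_on_Dcutoff: "continuous_on UNIV (Dcutoff a \<rho> m)"
proof (induction m)
  case 0
  then show ?case by (simp add: Dcutoff.simps(1)[abs_def])
next
  case (Suc m)
  have "continuous_on UNIV (\<lambda>x. b ((1 / \<rho> m) *\<^sub>R (x - a m)))"
    by (intro continuous_at_imp_continuous_on ballI has_derivative_continuous[OF has_derivative_scaled_bump])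
  moreover have "continuous_on UNIV (\<lambda>x. Db ((1 / \<rho> m) *\<^sub>R (x - a m)))"
    by (rule continuous_on_compose2[OF continuous_Db]) (auto intro!: continuous_intros)
  ultimately show ?case
    unfolding Dcutoff.simps(2)[abs_def] by (intro continuous_intros continuous_on_cutoff Suc)
qed

lemma cutoff_range: "0 \<le> cutoff a \<rho> m x \<and> cutoff a \<rho> m x \<le> 1"
  by (induction m) (auto simp: bump_range mult_le_one)

lemma norm_Dcutoff_le:
  assumes "\<And>i. 0 < \<rho> i"
  shows "norm (Dcutoff a \<rho> m x) \<le> (\<Sum>i<m. B / \<rho> i)"
proof (induction m)
  case (Suc m)
  let ?z = "(1 / \<rho> m) *\<^sub>R (x - a m)"
  have "norm (Dcutoff a \<rho> (Suc m) x) \<le> norm (cutoff a \<rho> m x *\<^sub>R ((1 / \<rho> m) *\<^sub>R Db ?z)) + norm (b ?z *\<^sub>R Dcutoff a \<rho> m x)"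
    by (simp only: Dcutoff.simps norm_triangle_ineq)
  also have "norm (cutoff a \<rho> m x *\<^sub>R ((1 / \<rho> m) *\<^sub>R Db ?z)) \<le> 1 * (1 / \<rho> m * B)"
    unfolding norm_scaleR using cutoff_range[of a \<rho> m x] assms[of m] norm_Db_le[of ?z]
    by (intro mult_mono) auto
  also have "norm (b ?z *\<^sub>R Dcutoff a \<rho> m x) \<le> 1 * (\<Sum>i<m. B / \<rho> i)"
    unfolding norm_scaleR using bump_range[of ?z] Suc by (intro mult_mono) auto
  finally show ?case by simp
qed simp

lemma vanishes_Dcutoff: "vanishes_on_kernel W (Dcutoff a \<rho> m x)"
  by (induction m)
     (simp_all add: vanishes_on_kernel_zero vanishes_on_kernel_add vanishes_on_kernel_scaleR vanishes_Db)

lemma cutoff_eq_0: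
  assumes "0 < \<rho> i" and "norm (x - a i) \<le> \<rho> i" and "i < m"
  shows "cutoff a \<rho> m x = 0 \<and> Dcutoff a \<rho> m x = 0"
proof -
  have "norm ((1 / \<rho> i) *\<^sub>R (x - a i)) \<le> 1"
    using assms(1,2) by simp
  then have "cutoff a \<rho> (Suc i) x = 0 \<and> Dcutoff a \<rho> (Suc i) x = 0"
    using bump_small by simp
  have "Suc i \<le> m" using assms(3) by simp
  then show ?thesis
  proof (induction m rule: dec_induct)
    case base
    show ?case by (rule \<open>cutoff a \<rho> (Suc i) x = 0 \<and> Dcutoff a \<rho> (Suc i) x = 0\<close>)
  qed simp
qed

lemma cutoff_Suc_eq:
  assumes "0 < \<rho> m" and "t * \<rho> m \<le> norm (x - a m)"
  shows "cutoff a \<rho> (Suc m) x = cutoff a \<rho> m x \<and> Dcutoff a \<rho> (Suc m) x = Dcutoff a \<rho> m x"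
proof -
  have "t \<le> norm ((1 / \<rho> m) *\<^sub>R (x - a m))"
    using assms by (simp add: pos_le_divide_eq)
  then show ?thesis
    using bump_large by simp
qed

text \<open>The sums telescope to 1 minus a product of cutoffs. Near \<open>a i\<close> every
  product that includes the factor \<open>i\<close> is zero, so the first \<open>Suc i\<close>
  functions already sum to 1. Outside the ball of radius \<open>t * \<rho> n\<close> the factor
  \<open>n\<close> is 1, so \<open>\<phi> n\<close> vanishes there. The bounds \<open>M n\<close>
  may grow with \<open>n\<close>, which the accuracy of the local pieces has to compensate.\<close>

lemma exists_C1_partition:
  assumes \<rho>: "\<And>i. 0 < \<rho> i"
  shows "\<exists>(\<phi> :: nat \<Rightarrow> 'a \<Rightarrow> real) D\<phi> M. (\<forall>n x. (\<phi> n has_derivative blinfun_apply (D\<phi> n x)) (at x)) \<and>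
    (\<forall>n. continuous_on UNIV (D\<phi> n)) \<and> (\<forall>n x. 0 \<le> \<phi> n x) \<and> (\<forall>n. 0 \<le> M n) \<and>
    (\<forall>n x. norm (D\<phi> n x) \<le> M n) \<and> (\<forall>n x. vanishes_on_kernel W (D\<phi> n x)) \<and>
    (\<forall>n x. t * \<rho> n \<le> norm (x - a n) \<longrightarrow> \<phi> n x = 0 \<and> D\<phi> n x = 0) \<and>
    (\<forall>i x. norm (x - a i) \<le> \<rho> i \<longrightarrow> (\<forall>n>i. \<phi> n x = 0 \<and> D\<phi> n x = 0) \<and>
      (\<Sum>n<Suc i. \<phi> n x) = 1 \<and> (\<Sum>n<Suc i. D\<phi> n x) = 0)"
proof -
  define \<phi> where "\<phi> n x = cutoff a \<rho> n x - cutoff a \<rho> (Suc n) x" for n x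
  define D\<phi> where "D\<phi> n x = Dcutoff a \<rho> n x - Dcutoff a \<rho> (Suc n) x" for n x
  define M where "M n = (\<Sum>i<n. B / \<rho> i) + (\<Sum>i<Suc n. B / \<rho> i)" for n
  have der: "(\<phi> n has_derivative blinfun_apply (D\<phi> n x)) (at x)" for n x
    unfolding \<phi>_def[abs_def]
    by (rule has_derivative_eq_rhs[OF has_derivative_diff[OF has_derivative_cutoff has_derivative_cutoff]])
       (simp add: fun_eq_iff D\<phi>_def blinfun.diff_left del: Dcutoff.simps)
  have cont: "continuous_on UNIV (D\<phi> n)" for n
    unfolding D\<phi>_def[abs_def] by (intro continuous_intros continuous_on_Dcutoff)
  have nonneg: "0 \<le> \<phi> n x" for n x
    using cutoff_range[of a \<rho> n x] bump_range[of "(1 / \<rho> n) *\<^sub>R (x - a n)"]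
    by (simp add: \<phi>_def mult_left_le)
  have M: "0 \<le> M n" for n
    using \<rho> B_pos unfolding M_def by (intro add_nonneg_nonneg sum_nonneg) (simp_all add: less_imp_le)
  have bound: "norm (D\<phi> n x) \<le> M n" for n x
    unfolding D\<phi>_def M_def using \<rho>
    by (intro order_trans[OF norm_triangle_ineq4] add_mono norm_Dcutoff_le)
  have van: "vanishes_on_kernel W (D\<phi> n x)" for n x
    using vanishes_on_kernel_add[OF vanishes_Dcutoff[of a \<rho> n x] vanishes_on_kernel_scaleR[OF vanishes_Dcutoff[of a \<rho> "Suc n" x], of "-1"]]
    by (simp add: D\<phi>_def del: Dcutoff.simps)
  have supp: "\<phi> n x = 0 \<and> D\<phi> n x = 0" if "t * \<rho> n \<le> norm (x - a n)" for n x
    using cutoff_Suc_eq[where \<rho> = \<rho> and m = n and x = x and a = a, OF \<rho> that] by (simp add: \<phi>_def D\<phi>_def del: cutoff.simps Dcutoff.simps)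
  have tele: "(\<Sum>n<m. \<phi> n x) = 1 - cutoff a \<rho> m x" "(\<Sum>n<m. D\<phi> n x) = - Dcutoff a \<rho> m x" for m x
    unfolding \<phi>_def D\<phi>_def by (subst sum_lessThan_telescope', simp)+
  have near: "(\<forall>n>i. \<phi> n x = 0 \<and> D\<phi> n x = 0) \<and> (\<Sum>n<Suc i. \<phi> n x) = 1 \<and> (\<Sum>n<Suc i. D\<phi> n x) = 0"
    if "norm (x - a i) \<le> \<rho> i" for i x
  proof -
    have z: "cutoff a \<rho> m x = 0 \<and> Dcutoff a \<rho> m x = 0" if "i < m" for m
      using cutoff_eq_0[where \<rho> = \<rho> and a = a and i = i and m = m and x = x, OF \<rho> \<open>norm (x - a i) \<le> \<rho> i\<close> that] .
    show ?thesis
      unfolding tele using z[of "Suc i"] z by (simp add: \<phi>_def D\<phi>_def del: cutoff.simps Dcutoff.simps)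
  qed
  show ?thesis
    by (intro exI[of _ \<phi>] exI[of _ D\<phi>] exI[of _ M] conjI allI impI)
       (use der cont nonneg M bound van supp near in blast)+
qed

end

text \<open>Values are averaged, so their error is harmless. In the derivative the weights are
  differentiated as well, and the terms with \<open>D\<phi> n\<close> are paid for by the factor
  \<open>M n\<close> and the geometric weights in \<open>close\<close>. The explicit form of
  \<open>Dg\<close> is kept in the conclusion for the proof of surjectivity.\<close>

lemma C1_glue:
  fixes f :: "'a::real_normed_vector \<Rightarrow> 'b::real_normed_vector"
    and \<phi> :: "nat \<Rightarrow> 'a \<Rightarrow> real"
  assumes "open U"
    and d\<phi>: "\<And>n x. (\<phi> n has_derivative blinfun_apply (D\<phi> n x)) (at x)"
    and c\<phi>: "\<And>n. continuous_on UNIV (D\<phi> n)" and nonneg: "\<And>n x. 0 \<le> \<phi> n x"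
    and M: "\<And>n. 0 \<le> M n" "\<And>n x. norm (D\<phi> n x) \<le> M n"
    and Q: "\<And>n. open (Q n)" and C: "\<And>n. closed (C n)" "\<And>n. C n \<subseteq> Q n"
    and supp: "\<And>n x. x \<notin> C n \<Longrightarrow> \<phi> n x = 0 \<and> D\<phi> n x = 0"
    and fin: "\<And>x. x \<in> U \<Longrightarrow> \<exists>i V. open V \<and> x \<in> V \<and> V \<subseteq> U \<and> (\<forall>y\<in>V. (\<forall>n\<ge>i. \<phi> n y = 0 \<and> D\<phi> n y = 0) \<and>
        (\<Sum>n<i. \<phi> n y) = 1 \<and> (\<Sum>n<i. D\<phi> n y) = 0)"
    and dG: "\<And>n x. x \<in> Q n \<Longrightarrow> (G n has_derivative blinfun_apply (DG n x)) (at x)"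
    and cG: "\<And>n. continuous_on (Q n) (DG n)"
    and close: "\<And>n x. x \<in> U \<Longrightarrow> x \<in> Q n \<Longrightarrow> norm (G n x - f x) \<le> \<epsilon> x \<and>
        M n * norm (G n x - f x) \<le> \<epsilon> x / (4 * 2 ^ n) \<and> norm (DG n x - Df x) \<le> \<epsilon> x / 2"
    and \<epsilon>: "\<And>x. x \<in> U \<Longrightarrow> 0 < \<epsilon> x"
  shows "\<exists>g Dg. (\<forall>x\<in>U. (g has_derivative blinfun_apply (Dg x)) (at x)) \<and> continuous_on U Dg \<and>
    (\<forall>x\<in>U. norm (f x - g x) \<le> \<epsilon> x) \<and> (\<forall>x\<in>U. norm (Df x - Dg x) \<le> \<epsilon> x) \<and>
    (\<forall>x\<in>U. \<exists>i. (\<Sum>n<i. \<phi> n x) = 1 \<and>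
       Dg x = (\<Sum>n<i. (blinfun_scaleR_left (G n x) o\<^sub>L D\<phi> n x) + \<phi> n x *\<^sub>R DG n x))"
proof -
  define u where "u n x = \<phi> n x *\<^sub>R G n x" for n x
  define Du where "Du n x = (blinfun_scaleR_left (G n x) o\<^sub>L D\<phi> n x) + \<phi> n x *\<^sub>R DG n x" for n x
  have z: "u n x = 0 \<and> Du n x = 0" if "\<phi> n x = 0 \<and> D\<phi> n x = 0" for n x
    using that by (simp add: u_def Du_def)
  have derQ: "(u n has_derivative blinfun_apply (Du n x)) (at x)" if "x \<in> Q n" for n x
    unfolding u_def[abs_def]
    by (rule has_derivative_eq_rhs[OF has_derivative_scaleR[OF d\<phi> dG[OF that]]])
       (simp add: fun_eq_iff Du_def blinfun.add_left blinfun.scaleR_left add.commute)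
  have der: "(u n has_derivative blinfun_apply (Du n x)) (at x)" for n x
  proof (cases "x \<in> Q n")
    case False
    \<comment> \<open>Nothing is known about \<open>G n\<close> outside \<open>Q n\<close>, but
      there the product is zero on the open set \<open>- C n\<close>, which together with
      \<open>Q n\<close> covers the space.\<close>
    then have "x \<in> - C n" using C(2) by blast
    then have "Du n x = 0" using z supp by blast
    then have "((\<lambda>_. 0) has_derivative blinfun_apply (Du n x)) (at x)"
      by (simp add: zero_blinfun.rep_eq)
    then show ?thesis
      by (rule has_derivative_transform_within_open[OF _ _ \<open>x \<in> - C n\<close>])
         (use C(1) z supp in \<open>auto simp: open_Compl\<close>)
  qed (rule derQ)
  have cont: "continuous_on S (Du n)" for n S
  proof -
    have "continuous_on (Q n) (Du n)"
    proof -
      have 1: "continuous_on (Q n) (G n)" "continuous_on (Q n) (\<phi> n)"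
        using has_derivative_continuous[OF dG] has_derivative_continuous[OF d\<phi>]
        by (auto intro!: continuous_at_imp_continuous_on)
      have 2: "continuous_on (Q n) (\<lambda>x. blinfun_scaleR_left (G n x))"
        by (rule bounded_linear.continuous_on[OF bounded_linear_blinfun_scaleR_left 1(1)])
      show ?thesis
        unfolding Du_def[abs_def]
        by (intro continuous_intros 1 2 cG continuous_on_subset[OF c\<phi>]) auto
    qed
    moreover have "continuous_on (- C n) (Du n)"
      using z supp by (subst continuous_on_cong[OF refl, of _ _ "\<lambda>_. 0"]) auto
    ultimately have "continuous_on (Q n \<union> - C n) (Du n)"
      using Q C(1) by (intro continuous_on_open_Un) auto
    moreover have "S \<subseteq> Q n \<union> - C n" using C(2) by auto
    ultimately show ?thesis
      by (rule continuous_on_subset)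
  qed
  have fin': "\<exists>m V. open V \<and> x \<in> V \<and> V \<subseteq> U \<and> (\<forall>y\<in>V. \<forall>n\<ge>m. u n y = 0 \<and> Du n y = 0)" if "x \<in> U" for x
    using fin[OF that] z by meson
  have "\<exists>g Dg. (\<forall>x\<in>U. (g has_derivative blinfun_apply (Dg x)) (at x)) \<and> continuous_on U Dg \<and>
    (\<forall>x\<in>U. \<forall>m. (\<forall>n\<ge>m. u n x = 0 \<and> Du n x = 0) \<longrightarrow> g x = (\<Sum>n<m. u n x) \<and> Dg x = (\<Sum>n<m. Du n x))"
    by (rule C1_locally_finite_sum) (rule der cont fin', assumption?)+
  then obtain g Dg where g: "\<forall>x\<in>U. (g has_derivative blinfun_apply (Dg x)) (at x)"
    "continuous_on U Dg"
    and sums: "\<forall>x\<in>U. \<forall>m. (\<forall>n\<ge>m. u n x = 0 \<and> Du n x = 0) \<longrightarrow>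
      g x = (\<Sum>n<m. u n x) \<and> Dg x = (\<Sum>n<m. Du n x)"
    by (elim exE conjE)
  have eq: "g x = (\<Sum>n<m. u n x) \<and> Dg x = (\<Sum>n<m. Du n x)"
    if "x \<in> U" "\<forall>n\<ge>m. u n x = 0 \<and> Du n x = 0" for x m
    using sums that by blast
  have main: "norm (f x - g x) \<le> \<epsilon> x \<and> norm (Df x - Dg x) \<le> \<epsilon> x \<and>
      (\<exists>i. (\<Sum>n<i. \<phi> n x) = 1 \<and> Dg x = (\<Sum>n<i. Du n x))" if x: "x \<in> U" for x
  proof -
    obtain i where i: "\<forall>n\<ge>i. \<phi> n x = 0 \<and> D\<phi> n x = 0" "(\<Sum>n<i. \<phi> n x) = 1" "(\<Sum>n<i. D\<phi> n x) = 0"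
      using fin[OF x] by blast
    have gx: "g x = (\<Sum>n<i. u n x)" "Dg x = (\<Sum>n<i. Du n x)"
      using eq[OF x, of i] z i(1) by auto
    have "g x - f x = (\<Sum>n<i. \<phi> n x *\<^sub>R (G n x - f x))"
      by (simp add: gx u_def scaleR_diff_right sum_subtractf i(2) flip: scaleR_sum_left)
    also have "norm \<dots> \<le> (\<Sum>n<i. \<phi> n x * \<epsilon> x)"
    proof (rule sum_norm_le)
      fix n
      show "norm (\<phi> n x *\<^sub>R (G n x - f x)) \<le> \<phi> n x * \<epsilon> x"
        using close[OF x, of n] supp[of x n] nonneg[of n x] C(2)[of n]
        by (cases "x \<in> C n") (auto intro!: mult_left_mono)
    qed
    also have "\<dots> = \<epsilon> x"
      by (simp add: i(2) flip: sum_distrib_right)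
    finally have 1: "norm (f x - g x) \<le> \<epsilon> x"
      by (simp add: norm_minus_commute)
    \<comment> \<open>As the \<open>D\<phi> n x\<close> sum to 0 and the \<open>\<phi> n x\<close>
      to 1, \<open>f x\<close> and \<open>Df x\<close> can be subtracted inside the sum; only the
      small differences meet the possibly large \<open>D\<phi> n x\<close>.\<close>
    have "Dg x - Df x = (\<Sum>n<i. (blinfun_scaleR_left (G n x - f x) o\<^sub>L D\<phi> n x) + \<phi> n x *\<^sub>R (DG n x - Df x))"
    proof (rule blinfun_eqI)
      fix v
      have "(\<Sum>n<i. blinfun_apply (D\<phi> n x) v) = 0"
        using i(3) by (metis blinfun.sum_left blinfun.zero_left)
      then have "(\<Sum>n<i. blinfun_apply (D\<phi> n x) v *\<^sub>R f x) = 0"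
        by (simp flip: scaleR_sum_left)
      moreover have "(\<Sum>n<i. \<phi> n x *\<^sub>R blinfun_apply (Df x) v) = blinfun_apply (Df x) v"
        by (simp add: i(2) flip: scaleR_sum_left)
      ultimately show "blinfun_apply (Dg x - Df x) v = blinfun_apply (\<Sum>n<i. (blinfun_scaleR_left (G n x - f x) o\<^sub>L D\<phi> n x) + \<phi> n x *\<^sub>R (DG n x - Df x)) v"
        by (simp add: gx Du_def blinfun.sum_left blinfun.add_left blinfun.diff_left blinfun.scaleR_left
            scaleR_diff_right sum.distrib sum_subtractf)
    qed
    also have "norm \<dots> \<le> (\<Sum>n<i. \<epsilon> x / 4 * (1 / 2 ^ n) + \<phi> n x * (\<epsilon> x / 2))"
    proof (rule sum_norm_le)
      fix n
      show "norm ((blinfun_scaleR_left (G n x - f x) o\<^sub>L D\<phi> n x) + \<phi> n x *\<^sub>R (DG n x - Df x))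
          \<le> \<epsilon> x / 4 * (1 / 2 ^ n) + \<phi> n x * (\<epsilon> x / 2)"
      proof (cases "x \<in> C n")
        case True
        then have cl: "M n * norm (G n x - f x) \<le> \<epsilon> x / (4 * 2 ^ n)" "norm (DG n x - Df x) \<le> \<epsilon> x / 2"
          using close[OF x, of n] C(2) by auto
        have "norm (blinfun_scaleR_left (G n x - f x) o\<^sub>L D\<phi> n x) \<le> M n * norm (G n x - f x)"
        proof (rule norm_blinfun_bound)
          fix v
          have "norm (blinfun_apply (D\<phi> n x) v) \<le> M n * norm v"
            using norm_blinfun[of "D\<phi> n x" v] M(2)[of n x]
            by (meson mult_right_mono norm_ge_zero order_trans)
          then have "norm (blinfun_apply (D\<phi> n x) v) * norm (G n x - f x) \<le> M n * norm v * norm (G n x - f x)"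
            by (rule mult_right_mono) simp
          then show "norm (blinfun_apply (blinfun_scaleR_left (G n x - f x) o\<^sub>L D\<phi> n x) v)
              \<le> M n * norm (G n x - f x) * norm v"
            by (simp add: mult_ac)
        qed (use M(1) in simp)
        also have "\<dots> \<le> \<epsilon> x / 4 * (1 / 2 ^ n)"
          using cl(1) by simp
        finally show ?thesis
          using mult_left_mono[OF cl(2) nonneg[of n x]] nonneg[of n x] by (intro norm_triangle_mono) simp_all
      next
        case False
        then show ?thesis
          using supp[of x n] \<epsilon>[OF x] by simp
      qed
    qed
    also have "\<dots> = \<epsilon> x / 4 * (\<Sum>n<i. 1 / 2 ^ n) + \<epsilon> x / 2"
      by (simp only: sum.distrib sum_distrib_left[symmetric] sum_distrib_right[symmetric] i(2) mult_1)
    also have "(\<Sum>n<i. 1 / 2 ^ n) \<le> (2::real)"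
    proof -
      have "(\<Sum>n<i. (1/2) ^ n) \<le> (\<Sum>n. (1/2::real) ^ n)"
        by (intro sum_le_suminf summable_geometric) auto
      then show ?thesis
        using sums_unique[OF geometric_sums[of "1/2::real"]] by (simp add: power_one_over)
    qed
    finally have 2: "norm (Df x - Dg x) \<le> \<epsilon> x"
      using \<epsilon>[OF x] by (simp add: norm_minus_commute mult_left_mono)
    show ?thesis
      using 1 2 i(2) gx(2) by blast
  qed
  show ?thesis
    unfolding Du_def[symmetric] using g main by (intro exI[of _ g] exI[of _ Dg]) blast
qed

section \<open>Local approximation near a point\<close>

text \<open>On the ball \<open>f - Df a\<close> has Lipschitz constant \<open>\<eta>\<close>, so a
  displacement by at most \<open>s\<close> changes its values by at most \<open>\<eta> * s\<close>,
  and its composition with \<open>\<Psi>\<close> has derivative at most \<open>\<eta> * C\<close>.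
  The derivative of this composition factors through \<open>D\<Psi>\<close>, hence the claim on
  kernels.\<close>

lemma (in unconditional_C1_bump) local_approximation:
  fixes f :: "'a \<Rightarrow> 'c::real_normed_vector"
  assumes C: "0 < C" and s: "0 < s" "s \<le> R / 4"
    and maps: "\<And>s. 0 < s \<Longrightarrow> \<exists>(\<Psi> :: 'a \<Rightarrow> 'a) D\<Psi>. (\<forall>x. (\<Psi> has_derivative blinfun_apply (D\<Psi> x)) (at x)) \<and>
      continuous_on UNIV D\<Psi> \<and> (\<forall>x. norm (\<Psi> x - x) \<le> s) \<and> (\<forall>x. norm (D\<Psi> x) \<le> C) \<and>
      (\<forall>x. vanishes_on_kernel kernel_functionals (D\<Psi> x))"
    and der: "\<And>x. x \<in> ball a R \<Longrightarrow> (f has_derivative blinfun_apply (Df x)) (at x)"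
    and cont: "continuous_on (ball a R) Df"
    and \<eta>: "\<And>x. x \<in> ball a R \<Longrightarrow> norm (Df x - Df a) \<le> \<eta>"
  shows "\<exists>H DH. (\<forall>x\<in>ball a (3 * R / 4). (H has_derivative blinfun_apply (DH x)) (at x) \<and>
      norm (H x - f x) \<le> \<eta> * s \<and> norm (DH x - Df x) \<le> \<eta> * C + \<eta>) \<and>
    continuous_on (ball a (3 * R / 4)) DH \<and>
    (\<forall>x. vanishes_on_kernel kernel_functionals (DH x - Df a))"
proof -
  obtain \<Psi> :: "'a \<Rightarrow> 'a" and D\<Psi> where d\<Psi>: "\<And>x. (\<Psi> has_derivative blinfun_apply (D\<Psi> x)) (at x)"
    and c\<Psi>: "continuous_on UNIV D\<Psi>" and near: "\<And>x. norm (\<Psi> x - x) \<le> s"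
    and bound: "\<And>x. norm (D\<Psi> x) \<le> C"
    and van: "\<And>x. vanishes_on_kernel kernel_functionals (D\<Psi> x)"
    using maps[OF s(1)] by auto
  define H where "H x = (f (\<Psi> x) - blinfun_apply (Df a) (\<Psi> x)) + blinfun_apply (Df a) x" for x
  define DH where "DH x = ((Df (\<Psi> x) - Df a) o\<^sub>L D\<Psi> x) + Df a" for x
  let ?Q = "ball a (3 * R / 4)"
  \<comment> \<open>Three quarters of the radius plus a displacement of at most one quarter keeps
    \<open>\<Psi> x\<close> in the ball where \<open>f\<close> is controlled.\<close>
  have in_ball: "\<Psi> x \<in> ball a R" "x \<in> ball a R" if "x \<in> ?Q" for x
    using that s near[of x] dist_triangle[of a "\<Psi> x" x] by (auto simp: dist_norm norm_minus_commute)
  have \<eta>0: "0 \<le> \<eta>"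
    using \<eta>[of a] s norm_ge_zero[of "Df a - Df a"] by simp
  have "(H has_derivative blinfun_apply (DH x)) (at x)" if "x \<in> ?Q" for x
  proof -
    have lin: "(blinfun_apply L has_derivative blinfun_apply L) F" for L :: "'a \<Rightarrow>\<^sub>L 'c" and F
      by (rule bounded_linear_imp_has_derivative[OF blinfun.bounded_linear_right])
    show ?thesis
      unfolding H_def[abs_def]
      by (rule has_derivative_eq_rhs[OF has_derivative_add[OF has_derivative_diff[OF
              has_derivative_compose[OF d\<Psi> der[OF in_ball(1)[OF that]]] has_derivative_compose[OF d\<Psi> lin]] lin]])
         (simp add: fun_eq_iff DH_def blinfun.add_left blinfun.diff_left)
  qed
  moreover have "norm (H x - f x) \<le> \<eta> * s" if "x \<in> ?Q" for x
  proof -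
    have "norm ((f (\<Psi> x) - blinfun_apply (Df a) (\<Psi> x)) - (f x - blinfun_apply (Df a) x)) \<le> \<eta> * norm (\<Psi> x - x)"
    proof (rule differentiable_bound[of "ball a R" "\<lambda>x. f x - blinfun_apply (Df a) x"
          "\<lambda>x. blinfun_apply (Df x - Df a)"])
      fix y assume y: "y \<in> ball a R"
      have "((\<lambda>x. f x - blinfun_apply (Df a) x) has_derivative blinfun_apply (Df y - Df a)) (at y)"
        by (rule has_derivative_eq_rhs[OF has_derivative_diff[OF der[OF y]
                bounded_linear_imp_has_derivative[OF blinfun.bounded_linear_right]]])
           (simp add: fun_eq_iff blinfun.diff_left)
      then show "((\<lambda>x. f x - blinfun_apply (Df a) x) has_derivative blinfun_apply (Df y - Df a)) (at y within ball a R)"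
        by (rule has_derivative_at_withinI)
      show "onorm (blinfun_apply (Df y - Df a)) \<le> \<eta>"
        using \<eta>[OF y] by (simp add: norm_blinfun.rep_eq)
    qed (use in_ball[OF that] in auto)
    also have "\<dots> \<le> \<eta> * s"
      using \<eta>0 near by (intro mult_left_mono) auto
    finally show ?thesis by (simp add: H_def algebra_simps)
  qed
  moreover have "norm (DH x - Df x) \<le> \<eta> * C + \<eta>" if "x \<in> ?Q" for x
  proof -
    have "norm (DH x - Df x) = norm (((Df (\<Psi> x) - Df a) o\<^sub>L D\<Psi> x) - (Df x - Df a))"
      by (simp add: DH_def algebra_simps)
    also have "\<dots> \<le> norm ((Df (\<Psi> x) - Df a) o\<^sub>L D\<Psi> x) + norm (Df x - Df a)"
      by (rule norm_triangle_ineq4)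
    also have "norm ((Df (\<Psi> x) - Df a) o\<^sub>L D\<Psi> x) \<le> norm (Df (\<Psi> x) - Df a) * norm (D\<Psi> x)"
      by (rule norm_blinfun_compose)
    also have "\<dots> \<le> \<eta> * C"
      using \<eta>0 in_ball[OF that] by (intro mult_mono \<eta> bound) auto
    finally show ?thesis
      using \<eta>[OF in_ball(2)[OF that]] by simp
  qed
  moreover have "continuous_on ?Q DH"
  proof -
    have "continuous_on ?Q \<Psi>"
      by (intro continuous_at_imp_continuous_on ballI has_derivative_continuous[OF d\<Psi>])
    then have "continuous_on ?Q (\<lambda>x. Df (\<Psi> x))"
      by (rule continuous_on_compose2[OF cont]) (use in_ball in auto)
    then show ?thesis
      unfolding DH_def[abs_def] by (intro continuous_intros continuous_on_subset[OF c\<Psi>]) auto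
  qed
  moreover have "vanishes_on_kernel kernel_functionals (DH x - Df a)" for x
    by (simp add: DH_def vanishes_on_kernel_compose_left van)
  ultimately show ?thesis
    by (intro exI[of _ H] exI[of _ DH]) blast
qed

section \<open>Surjectivity and the final construction\<close>

text \<open>On the common kernel of \<open>S\<close> the operator \<open>A\<close> coincides with
  \<open>s *\<^sub>R T\<close>, which is already onto there.\<close>

lemma surj_of_vanishing_difference:
  assumes T: "\<And>S y. finite S \<Longrightarrow> S \<subseteq> W \<Longrightarrow> \<exists>v. (\<forall>L\<in>S. blinfun_apply L v = 0) \<and> blinfun_apply T v = y"
    and "vanishes_on_kernel W (A - s *\<^sub>R T)" and "s \<noteq> 0"
  shows "surj (blinfun_apply A)"
proof -
  obtain S where S: "finite S" "S \<subseteq> W"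
    "\<forall>v. (\<forall>L\<in>S. blinfun_apply L v = 0) \<longrightarrow> blinfun_apply (A - s *\<^sub>R T) v = 0"
    using assms(2) unfolding vanishes_on_kernel_def by auto
  define h where "h y = (SOME v. (\<forall>L\<in>S. blinfun_apply L v = 0) \<and> blinfun_apply T v = (1 / s) *\<^sub>R y)" for y
  have h: "(\<forall>L\<in>S. blinfun_apply L (h y) = 0) \<and> blinfun_apply T (h y) = (1 / s) *\<^sub>R y" for y
    unfolding h_def by (rule someI_ex[OF T[OF S(1,2)]])
  have "blinfun_apply A (h y) = y" for y
  proof -
    have "blinfun_apply (A - s *\<^sub>R T) (h y) = 0"
      using h[of y] S(3) by blast
    then show ?thesis
      using h[of y] \<open>s \<noteq> 0\<close> by (simp add: blinfun.diff_left blinfun.scaleR_left)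
  qed
  then show ?thesis
    by (rule surjI)
qed

text \<open>Since the target is finite-dimensional, an arbitrary operator adds only finitely many
  functionals to \<open>Z\<close>; so the uncontrolled \<open>Df (a n)\<close> can be
  accommodated.\<close>

lemma vanishes_on_kernel_components:
  fixes A :: "'a::real_normed_vector \<Rightarrow>\<^sub>L (real ^ 'd)"
  shows "vanishes_on_kernel (range (\<lambda>i. blinfun_inner_left (axis i 1) o\<^sub>L A)) A"
proof (rule vanishes_on_kernelI[OF _ subset_refl])
  fix v assume *: "\<And>L. L \<in> range (\<lambda>i. blinfun_inner_left (axis i 1) o\<^sub>L A) \<Longrightarrow> blinfun_apply L v = 0"
  have "blinfun_apply A v $ i = 0" for i
    using *[of "blinfun_inner_left (axis i 1) o\<^sub>L A"] by (simp add: blinfun_inner_left.rep_eq inner_axis)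
  then show "blinfun_apply A v = 0"
    by (simp add: vec_eq_iff)
qed simp

theorem theorem3p1:
  fixes U :: "'a::banach set"
    and f :: "'a \<Rightarrow> real ^ 'd"
    and Df :: "'a \<Rightarrow> ('a \<Rightarrow>\<^sub>L (real ^ 'd))"
    and \<epsilon> :: "'a \<Rightarrow> real"
  assumes "infinite_dimensional TYPE('a)"
    and "\<exists>e :: nat \<Rightarrow> 'a. unconditional_basis e"
    and "\<exists>N :: 'a \<Rightarrow> real. equivalent_norm N \<and> C1_away_from_origin N
            \<and> locally_depends_on_finitely_many_coords N"
    and "open U"
    and "\<forall>x\<in>U. (f has_derivative blinfun_apply (Df x)) (at x)"
    and "continuous_on U Df"
    and "continuous_on U \<epsilon>"
    and "\<forall>x\<in>U. 0 < \<epsilon> x"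
  shows "\<exists>(g :: 'a \<Rightarrow> real ^ 'd) (Dg :: 'a \<Rightarrow> ('a \<Rightarrow>\<^sub>L (real ^ 'd))).
           (\<forall>x\<in>U. (g has_derivative blinfun_apply (Dg x)) (at x)) \<and>
           continuous_on U Dg \<and>
           (\<forall>x\<in>U. norm (f x - g x) \<le> \<epsilon> x) \<and>
           (\<forall>x\<in>U. norm (Df x - Dg x) \<le> \<epsilon> x) \<and>
           (\<forall>x\<in>U. surj (blinfun_apply (Dg x)))"
proof (cases "U = {}")
  case True
  then show ?thesis by simp
next
  case False
  obtain e :: "nat \<Rightarrow> 'a" where "unconditional_basis e"
    using assms(2) ..
  then interpret unconditional_schauder_basis e
    by unfold_locales
  obtain D :: "'a set" where D: "countable D" "closure D = UNIV"
    using countable_dense by blast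
  obtain b :: "'a \<Rightarrow> real" and Db W t B where "C1_bump b Db W t B"
    using exists_C1_bump[OF D] assms(3) by blast
  then interpret C1_bump b Db W t B .
  interpret unconditional_C1_bump e b Db W t B
    by unfold_locales
  from exists_nearer_identity obtain C0 where C0: "0 < C0"
    and maps: "\<forall>s>0. \<exists>(\<Psi> :: 'a \<Rightarrow> 'a) D\<Psi>. (\<forall>x. (\<Psi> has_derivative blinfun_apply (D\<Psi> x)) (at x)) \<and>
      continuous_on UNIV D\<Psi> \<and> (\<forall>x. norm (\<Psi> x - x) \<le> s) \<and> (\<forall>x. norm (D\<Psi> x) \<le> C0) \<and>
      (\<forall>x. vanishes_on_kernel kernel_functionals (D\<Psi> x))"
    by (elim exE conjE)
  \<comment> \<open>Chosen so that the derivative error \<open>\<eta> * C0 + \<eta>\<close> of the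
    local approximation is exactly \<open>\<epsilon> a / 16\<close>.\<close>
  define \<eta> where "\<eta> a = \<epsilon> a / 16 / (1 + C0)" for a
  have \<epsilon>: "0 < \<epsilon> x" if "x \<in> U" for x
    using assms(8) that by blast
  have \<eta>: "0 < \<eta> a" "\<eta> a * C0 + \<eta> a = \<epsilon> a / 16" if "a \<in> U" for a
  proof -
    show "0 < \<eta> a"
      using \<epsilon>[OF that] C0 by (simp add: \<eta>_def)
    have "\<eta> a * C0 + \<eta> a = \<eta> a * (1 + C0)"
      by (simp add: algebra_simps)
    also have "\<dots> = \<epsilon> a / 16"
      using C0 nonzero_eq_divide_eq[of "1 + C0" "\<eta> a" "\<epsilon> a / 16"] \<eta>_def[of a] by linarith
    finally show "\<eta> a * C0 + \<eta> a = \<epsilon> a / 16" .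
  qed
  have "\<exists>R>0. ball a R \<subseteq> U \<and> (\<forall>x\<in>ball a R. norm (Df x - Df a) \<le> \<eta> a \<and> \<epsilon> a \<le> 2 * \<epsilon> x)" if a: "a \<in> U" for a
  proof -
    obtain r1 where r1: "0 < r1" "ball a r1 \<subseteq> U"
      using assms(4) a by (meson open_contains_ball)
    obtain r2 where r2: "0 < r2" "\<And>x. x \<in> U \<Longrightarrow> dist x a < r2 \<Longrightarrow> dist (Df x) (Df a) < \<eta> a"
      using assms(6) a \<eta>(1)[OF a] unfolding continuous_on_iff by metis
    obtain r3 where r3: "0 < r3" "\<And>x. x \<in> U \<Longrightarrow> dist x a < r3 \<Longrightarrow> dist (\<epsilon> x) (\<epsilon> a) < \<epsilon> a / 2"
      using assms(7) a half_gt_zero[OF \<epsilon>[OF a]] unfolding continuous_on_iff by metis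
    define R where "R = min r1 (min r2 r3)"
    have "norm (Df x - Df a) \<le> \<eta> a \<and> \<epsilon> a \<le> 2 * \<epsilon> x" if "x \<in> ball a R" for x
    proof -
      have x: "x \<in> U" "dist x a < r2" "dist x a < r3"
        using that r1 by (auto simp: R_def dist_commute)
      show ?thesis
        using r2(2)[OF x(1,2)] r3(2)[OF x(1,3)] by (auto simp: dist_norm dist_real_def abs_if split: if_splits)
    qed
    then show ?thesis
      using r1 r2(1) r3(1) by (intro exI[of _ R]) (auto simp: R_def)
  qed
  then obtain R where R: "\<And>a. a \<in> U \<Longrightarrow> 0 < R a" "\<And>a. a \<in> U \<Longrightarrow> ball a (R a) \<subseteq> U"
    "\<And>a x. a \<in> U \<Longrightarrow> x \<in> ball a (R a) \<Longrightarrow> norm (Df x - Df a) \<le> \<eta> a \<and> \<epsilon> a \<le> 2 * \<epsilon> x"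
    by metis
  \<comment> \<open>With covering radius \<open>R a / (2 * t)\<close> the partition functions are
    supported in balls of radius \<open>R a / 2\<close>. This leaves room for the domains
    \<open>Q n\<close> of radius \<open>3 * R a / 4\<close> and for the displacement by
    \<open>\<Psi>\<close>.\<close>
  obtain A where A: "countable A" "A \<subseteq> U" "U \<subseteq> (\<Union>a\<in>A. ball a (R a / (2 * t)))"
    using countable_subcover_of_dense[OF D, of U "\<lambda>a. ball a (R a / (2 * t))"] R(1) t_pos by auto
  then have "A \<noteq> {}" using False by auto
  define a where "a = from_nat_into A"
  have range_a: "range a = A"
    unfolding a_def by (rule range_from_nat_into[OF \<open>A \<noteq> {}\<close> A(1)])
  then have aU: "a n \<in> U" for n
    using A(2) by blast
  define r where "r n = R (a n)" for n
  have r: "0 < r n" "ball (a n) (r n) \<subseteq> U" for n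
    using R(1,2)[OF aU] by (auto simp: r_def)
  have rx: "norm (Df x - Df (a n)) \<le> \<eta> (a n)" "\<epsilon> (a n) \<le> 2 * \<epsilon> x" if "x \<in> ball (a n) (r n)" for n x
    using R(3)[OF aU] that by (auto simp: r_def)
  define \<rho> where "\<rho> n = r n / (2 * t)" for n
  have \<rho>: "0 < \<rho> n" "t * \<rho> n = r n / 2" for n
    using r t_pos by (auto simp: \<rho>_def)
  have cover: "\<exists>n. x \<in> ball (a n) (\<rho> n)" if "x \<in> U" for x
    using A(3) that range_a unfolding \<rho>_def r_def by fastforce
  from exists_C1_partition[where \<rho> = \<rho> and a = a, OF \<rho>(1)]
  obtain \<phi> :: "nat \<Rightarrow> 'a \<Rightarrow> real" and D\<phi> M where d\<phi>: "\<forall>n x. (\<phi> n has_derivative blinfun_apply (D\<phi> n x)) (at x)"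
    and c\<phi>: "\<forall>n. continuous_on UNIV (D\<phi> n)" and nonneg: "\<forall>n x. 0 \<le> \<phi> n x"
    and M: "\<forall>n. 0 \<le> M n" "\<forall>n x. norm (D\<phi> n x) \<le> M n"
    and van\<phi>: "\<forall>n x. vanishes_on_kernel W (D\<phi> n x)"
    and supp: "\<forall>n x. t * \<rho> n \<le> norm (x - a n) \<longrightarrow> \<phi> n x = 0 \<and> D\<phi> n x = 0"
    and near: "\<forall>i x. norm (x - a i) \<le> \<rho> i \<longrightarrow> (\<forall>n>i. \<phi> n x = 0 \<and> D\<phi> n x = 0) \<and>
      (\<Sum>n<Suc i. \<phi> n x) = 1 \<and> (\<Sum>n<Suc i. D\<phi> n x) = 0"
    by (elim exE conjE)
  \<comment> \<open>The three parts serve the operators \<open>DH n x - Df (a n)\<close>,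
    \<open>D\<phi> n x\<close> and \<open>Df (a n)\<close>. None of them involves \<open>T\<close>,
    which is chosen afterwards.\<close>
  define Z where "Z = kernel_functionals \<union> W \<union> (\<Union>n. range (\<lambda>i. blinfun_inner_left (axis i 1) o\<^sub>L Df (a n)))"
  have "countable Z"
    unfolding Z_def using countable_kernel_functionals countable_W by auto
  from exists_surjective_on_kernels[OF assms(1) this] obtain T :: "'a \<Rightarrow>\<^sub>L (real ^ 'd)"
    where T: "\<forall>S. finite S \<longrightarrow> S \<subseteq> Z \<longrightarrow> (\<forall>y. \<exists>v. (\<forall>L\<in>S. blinfun_apply L v = 0) \<and> blinfun_apply T v = y)"
    by (rule exE)
  \<comment> \<open>The admissible error in the values of piece \<open>n\<close>: it offsets the
    derivative bound \<open>M n\<close> of the partition function and makes the errors summable.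
    Half of it goes to the local approximation through \<open>s n\<close>, half to the perturbation
    by \<open>T\<close> through \<open>c n\<close>.\<close>
  define \<delta> where "\<delta> n = \<epsilon> (a n) / (16 * 2 ^ n * (1 + M n))" for n
  have M1: "0 < 1 + M n" for n
    using M(1) by (simp add: add_pos_nonneg)
  have \<delta>: "0 < \<delta> n" "\<delta> n \<le> \<epsilon> (a n) / 16" "M n * \<delta> n \<le> \<epsilon> (a n) / (16 * 2 ^ n)" for n
  proof -
    show "0 < \<delta> n"
      using \<epsilon>[OF aU] M1 by (simp add: \<delta>_def)
    have "1 \<le> (2::real) ^ n * (1 + M n)"
      using mult_mono[of 1 "(2::real) ^ n" 1 "1 + M n"] M(1) by simp
    then have "16 \<le> 16 * 2 ^ n * (1 + M n)"
      by simp
    then show "\<delta> n \<le> \<epsilon> (a n) / 16"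
      unfolding \<delta>_def using \<epsilon>[OF aU, of n] by (intro divide_left_mono) auto
    have "M n * \<delta> n = (\<epsilon> (a n) / (16 * 2 ^ n)) * (M n / (1 + M n))"
      by (simp add: \<delta>_def)
    also have "\<dots> \<le> (\<epsilon> (a n) / (16 * 2 ^ n)) * 1"
      using \<epsilon>[OF aU, of n] M1[of n] M(1) by (intro mult_left_mono) (auto simp: divide_le_eq)
    finally show "M n * \<delta> n \<le> \<epsilon> (a n) / (16 * 2 ^ n)" by simp
  qed
  \<comment> \<open>A linear map is bounded only on bounded sets;
    \<open>1 + norm (a n) + r n\<close> bounds the norm on the ball around \<open>a n\<close>, and
    being at least 1 it also yields the estimate for the derivative
    \<open>c n *\<^sub>R T\<close>.\<close>
  define c where "c n = \<delta> n / (2 * (1 + norm T) * (1 + norm (a n) + r n))" for n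
  have T1: "0 < 1 + norm T"
    by (simp add: add_pos_nonneg)
  have c: "0 < c n" "c n * norm T * (1 + norm (a n) + r n) \<le> \<delta> n / 2" "c n * norm T \<le> \<delta> n / 2" for n
  proof -
    have p: "1 \<le> 1 + norm (a n) + r n" using r(1)[of n] by simp
    show "0 < c n"
      using \<delta>(1)[of n] T1 p by (simp add: c_def)
    have "c n * norm T * (1 + norm (a n) + r n) = \<delta> n / 2 * (norm T / (1 + norm T))"
      using p T1 by (simp add: c_def)
    also have "\<dots> \<le> \<delta> n / 2 * 1"
      using \<delta>(1)[of n] T1 by (intro mult_left_mono) (auto simp: divide_le_eq)
    finally show 1: "c n * norm T * (1 + norm (a n) + r n) \<le> \<delta> n / 2" by simp
    have "c n * norm T * 1 \<le> c n * norm T * (1 + norm (a n) + r n)"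
      using p \<open>0 < c n\<close> by (intro mult_left_mono) auto
    with 1 show "c n * norm T \<le> \<delta> n / 2" by simp
  qed
  define s where "s n = min (r n / 4) (\<delta> n / (2 * \<eta> (a n)))" for n
  have s: "0 < s n" "s n \<le> r n / 4" "\<eta> (a n) * s n \<le> \<delta> n / 2" for n
  proof -
    show "0 < s n" "s n \<le> r n / 4"
      using r(1)[of n] \<delta>(1)[of n] \<eta>(1)[OF aU, of n] by (auto simp: s_def)
    have "\<eta> (a n) * s n \<le> \<eta> (a n) * (\<delta> n / (2 * \<eta> (a n)))"
      using \<eta>(1)[OF aU, of n] by (intro mult_left_mono) (auto simp: s_def)
    then show "\<eta> (a n) * s n \<le> \<delta> n / 2"
      using \<eta>(1)[OF aU, of n] by simp
  qed
  define Q where "Q n = ball (a n) (3 * r n / 4)" for n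
  have Q: "Q n \<subseteq> ball (a n) (r n)" for n
    using r(1)[of n] by (auto simp: Q_def)
  have "\<exists>H DH. (\<forall>x\<in>Q n. (H has_derivative blinfun_apply (DH x)) (at x) \<and>
      norm (H x - f x) \<le> \<eta> (a n) * s n \<and> norm (DH x - Df x) \<le> \<eta> (a n) * C0 + \<eta> (a n)) \<and>
    continuous_on (Q n) DH \<and>
    (\<forall>x. vanishes_on_kernel kernel_functionals (DH x - Df (a n)))" for n
    unfolding Q_def
  proof (rule local_approximation[OF C0 s(1,2)])
    show "(f has_derivative blinfun_apply (Df x)) (at x)" if "x \<in> ball (a n) (r n)" for x
      using assms(5) r(2) that by blast
    show "continuous_on (ball (a n) (r n)) Df"
      by (rule continuous_on_subset[OF assms(6) r(2)])
  qed (use maps rx in auto)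
  then obtain H DH where dH: "\<And>n x. x \<in> Q n \<Longrightarrow> (H n has_derivative blinfun_apply (DH n x)) (at x)"
    and nH: "\<And>n x. x \<in> Q n \<Longrightarrow> norm (H n x - f x) \<le> \<eta> (a n) * s n"
    and nDH: "\<And>n x. x \<in> Q n \<Longrightarrow> norm (DH n x - Df x) \<le> \<eta> (a n) * C0 + \<eta> (a n)"
    and cH: "\<And>n. continuous_on (Q n) (DH n)"
    and vanH: "\<And>n x. vanishes_on_kernel kernel_functionals (DH n x - Df (a n))"
    by metis
  define G where "G n x = H n x + c n *\<^sub>R blinfun_apply T x" for n x
  define DG where "DG n x = DH n x + c n *\<^sub>R T" for n x
  have close: "norm (G n x - f x) \<le> \<delta> n \<and> norm (DG n x - Df x) \<le> \<epsilon> (a n) / 8" if x: "x \<in> Q n" for n x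
  proof
    have "norm x \<le> norm (a n) + norm (x - a n)"
      using norm_triangle_sub by blast
    then have "norm x \<le> 1 + norm (a n) + r n"
      using x Q[of n] by (auto simp: dist_norm norm_minus_commute)
    have "norm (c n *\<^sub>R blinfun_apply T x) \<le> c n * norm T * norm x"
      using mult_left_mono[OF norm_blinfun[of T x], of "c n"] c(1)[of n] by (simp add: mult.assoc)
    also have "\<dots> \<le> c n * norm T * (1 + norm (a n) + r n)"
      using c(1)[of n] by (intro mult_left_mono \<open>norm x \<le> 1 + norm (a n) + r n\<close>) auto
    also have "\<dots> \<le> \<delta> n / 2"
      by (rule c(2))
    finally have "norm ((H n x - f x) + c n *\<^sub>R blinfun_apply T x) \<le> \<delta> n / 2 + \<delta> n / 2"
      using nH[OF x] s(3)[of n] by (intro norm_triangle_mono) auto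
    then show "norm (G n x - f x) \<le> \<delta> n"
      by (simp add: G_def algebra_simps)
    have "norm ((DH n x - Df x) + c n *\<^sub>R T) \<le> \<epsilon> (a n) / 16 + \<epsilon> (a n) / 16"
      using nDH[OF x] \<eta>(2)[OF aU, of n] c(1,3)[of n] \<delta>(1,2)[of n] by (intro norm_triangle_mono) auto
    then show "norm (DG n x - Df x) \<le> \<epsilon> (a n) / 8"
      by (simp add: DG_def algebra_simps)
  qed
  have "\<exists>g Dg. (\<forall>x\<in>U. (g has_derivative blinfun_apply (Dg x)) (at x)) \<and> continuous_on U Dg \<and>
    (\<forall>x\<in>U. norm (f x - g x) \<le> \<epsilon> x) \<and> (\<forall>x\<in>U. norm (Df x - Dg x) \<le> \<epsilon> x) \<and>
    (\<forall>x\<in>U. \<exists>i. (\<Sum>n<i. \<phi> n x) = 1 \<and>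
       Dg x = (\<Sum>n<i. (blinfun_scaleR_left (G n x) o\<^sub>L D\<phi> n x) + \<phi> n x *\<^sub>R DG n x))"
  proof (rule C1_glue[where Q = Q and C = "\<lambda>n. cball (a n) (r n / 2)" and M = M])
    show "\<phi> n x = 0 \<and> D\<phi> n x = 0" if "x \<notin> cball (a n) (r n / 2)" for n x
      using supp[rule_format, of n x] that \<rho>(2)[of n] by (auto simp: dist_norm norm_minus_commute)
    show "cball (a n) (r n / 2) \<subseteq> Q n" for n
      using r(1)[of n] by (auto simp: Q_def)
    show "\<exists>i V. open V \<and> x \<in> V \<and> V \<subseteq> U \<and> (\<forall>y\<in>V. (\<forall>n\<ge>i. \<phi> n y = 0 \<and> D\<phi> n y = 0) \<and>
        (\<Sum>n<i. \<phi> n y) = 1 \<and> (\<Sum>n<i. D\<phi> n y) = 0)" if x: "x \<in> U" for x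
    proof -
      obtain i where i: "x \<in> ball (a i) (\<rho> i)"
        using cover[OF x] by blast
      have "(\<forall>n\<ge>Suc i. \<phi> n y = 0 \<and> D\<phi> n y = 0) \<and> (\<Sum>n<Suc i. \<phi> n y) = 1 \<and> (\<Sum>n<Suc i. D\<phi> n y) = 0"
        if "y \<in> U \<inter> ball (a i) (\<rho> i)" for y
      proof -
        have "norm (y - a i) \<le> \<rho> i"
          using that by (simp add: dist_norm norm_minus_commute)
        from near[THEN spec, THEN spec, THEN mp, OF this] show ?thesis
          by (simp add: Suc_le_eq del: sum.lessThan_Suc)
      qed
      then show ?thesis
        using x i assms(4) by (intro exI[of _ "Suc i"] exI[of _ "U \<inter> ball (a i) (\<rho> i)"]) auto
    qed
    show "(G n has_derivative blinfun_apply (DG n x)) (at x)" if "x \<in> Q n" for n x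
      unfolding G_def[abs_def]
      by (rule has_derivative_eq_rhs[OF has_derivative_add[OF dH[OF that] has_derivative_scaleR_right[OF
              bounded_linear_imp_has_derivative[OF blinfun.bounded_linear_right]]]])
         (simp add: fun_eq_iff DG_def blinfun.add_left blinfun.scaleR_left)
    show "continuous_on (Q n) (DG n)" for n
      unfolding DG_def[abs_def] by (intro continuous_intros cH)
    show "norm (G n x - f x) \<le> \<epsilon> x \<and> M n * norm (G n x - f x) \<le> \<epsilon> x / (4 * 2 ^ n) \<and>
        norm (DG n x - Df x) \<le> \<epsilon> x / 2" if x: "x \<in> U" "x \<in> Q n" for n x
    proof -
      have \<epsilon>n: "\<epsilon> (a n) \<le> 2 * \<epsilon> x"
        using rx(2) x(2) Q by blast
      have cl: "norm (G n x - f x) \<le> \<delta> n" "norm (DG n x - Df x) \<le> \<epsilon> (a n) / 8"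
        using close[OF x(2)] by auto
      have "M n * norm (G n x - f x) \<le> M n * \<delta> n"
        using M(1) cl(1) by (intro mult_left_mono) auto
      also have "\<dots> \<le> \<epsilon> (a n) / (16 * 2 ^ n)"
        by (rule \<delta>(3))
      also have "\<dots> \<le> (4 * \<epsilon> x) / (16 * 2 ^ n)"
        using \<epsilon>n \<epsilon>[OF x(1)] by (intro divide_right_mono) auto
      also have "\<dots> = \<epsilon> x / (4 * 2 ^ n)"
        by simp
      finally show ?thesis
        using cl \<epsilon>n \<epsilon>[OF x(1)] \<delta>(2)[of n] by auto
    qed
  qed (use assms(4) d\<phi> c\<phi> nonneg M \<epsilon> in \<open>auto simp: Q_def\<close>)
  then obtain g Dg where g: "\<forall>x\<in>U. (g has_derivative blinfun_apply (Dg x)) (at x)" "continuous_on U Dg"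
    "\<forall>x\<in>U. norm (f x - g x) \<le> \<epsilon> x" "\<forall>x\<in>U. norm (Df x - Dg x) \<le> \<epsilon> x"
    and Dg: "\<forall>x\<in>U. \<exists>i. (\<Sum>n<i. \<phi> n x) = 1 \<and>
       Dg x = (\<Sum>n<i. (blinfun_scaleR_left (G n x) o\<^sub>L D\<phi> n x) + \<phi> n x *\<^sub>R DG n x)"
    by (elim exE conjE)
  have "surj (blinfun_apply (Dg x))" if x: "x \<in> U" for x
  proof -
    obtain i where i: "(\<Sum>n<i. \<phi> n x) = 1"
      "Dg x = (\<Sum>n<i. (blinfun_scaleR_left (G n x) o\<^sub>L D\<phi> n x) + \<phi> n x *\<^sub>R DG n x)"
      using Dg x by blast
    \<comment> \<open>The total weight of \<open>T\<close> in \<open>Dg x\<close>. It is positive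
      because the nonnegative \<open>\<phi> n x\<close> sum to 1 and every \<open>c n\<close> is
      positive. The remaining occurrences of \<open>T\<close> are inside the vectors
      \<open>G n x\<close>, which do not affect the kernels.\<close>
    define \<sigma> where "\<sigma> = (\<Sum>n<i. \<phi> n x * c n)"
    have "\<sigma> > 0"
    proof -
      obtain k where k: "k < i" "\<phi> k x \<noteq> 0"
        using i(1) by (metis lessThan_iff sum.neutral zero_neq_one)
      then have "0 < \<phi> k x"
        using nonneg by (simp add: less_le)
      then show ?thesis
        unfolding \<sigma>_def using k c(1) nonneg
        by (intro sum_pos2[of _ k]) (simp_all add: less_imp_le[OF c(1)])
    qed
    have "Dg x - \<sigma> *\<^sub>R T = (\<Sum>n<i. (blinfun_scaleR_left (G n x) o\<^sub>L D\<phi> n x)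
        + \<phi> n x *\<^sub>R ((DH n x - Df (a n)) + Df (a n)))"
      by (simp add: i(2) DG_def \<sigma>_def scaleR_add_right scaleR_sum_left sum.distrib)
    moreover have "vanishes_on_kernel Z \<dots>"
    proof (intro vanishes_on_kernel_sum)
      fix n
      have "vanishes_on_kernel Z (blinfun_scaleR_left (G n x) o\<^sub>L D\<phi> n x)"
        by (rule vanishes_on_kernel_compose_left[OF vanishes_on_kernel_mono[OF van\<phi>[rule_format]]])
           (auto simp: Z_def)
      moreover have "vanishes_on_kernel Z (DH n x - Df (a n))"
        by (rule vanishes_on_kernel_mono[OF vanH]) (auto simp: Z_def)
      moreover have "vanishes_on_kernel Z (Df (a n))"
        by (rule vanishes_on_kernel_mono[OF vanishes_on_kernel_components]) (auto simp: Z_def)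
      ultimately show "vanishes_on_kernel Z ((blinfun_scaleR_left (G n x) o\<^sub>L D\<phi> n x)
        + \<phi> n x *\<^sub>R ((DH n x - Df (a n)) + Df (a n)))"
        by (intro vanishes_on_kernel_add vanishes_on_kernel_scaleR)
    qed simp
    ultimately have "vanishes_on_kernel Z (Dg x - \<sigma> *\<^sub>R T)"
      by simp
    then show ?thesis
      using surj_of_vanishing_difference[of Z T "Dg x" \<sigma>] T \<open>\<sigma> > 0\<close> by simp
  qed
  then show ?thesis
    using g by blast
qed

end
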